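(* Let $a\ge2$ and $k\ge1$ be fixed integers. (i) $$\mathbb{E}[(Y_{n,k}^{(a)})^2]\sim\frac{1}{(k!)^2}\,\frac{1}{a^{2k}}\binom{k+a-1}{k}^2n^{2k}\qquad\text{as }n\to\infty,$$ where $$\mathbb{E}[(Y_{n,k}^{(a)})^2]=\sum_{t=0}^{k}\ \sum_{s=0}^{\min(a-1,k-t)}a^{-(2k-t)}4^{k-t}\binom{n}{2k-t}\binom{k-t-s-1/2}{k-t-s}\binom{s+(t+1)/2-1}{s}\binom{2k-t-s+a-1}{t+2s}\binom{2k-2t-3s+a-1}{-s+a-1}.$$ (ii) $$\mathrm{Var}(Y_{n,k}^{(a)})\sim C(k,a)\,n^{2k-1}\qquad\text{as }n\to\infty,$$ where $$C(k,a)=\frac{1}{a^{2k}}\left[\frac{a}{(2k-1)!}\left(\sum_{s=0}^{\min(a-1,k-1)}4^s\frac{(2k+a-s-2)!}{(2s+1)!\,(a-s-1)!\,((k-s-1)!)^2}\right)-\frac{1}{((k-1)!)^2}\binom{k+a-1}{k}^2\right].$$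
   Context: $X_1,X_2,\ldots$ are i.i.d. uniform on $[a]=\{1,\ldots,a\}$ and $Y_{n,k}^{(a)}=\sum_{1\le i_1<\cdots<i_k\le n}\mathbf{1}(X_{i_1}\le\cdots\le X_{i_k})$ is the number of weakly increasing subsequences of length $k$ of $X_1,\ldots,X_n$. For real $x$ and integer $m\ge0$, $\binom{x}{m}=x(x-1)\cdots(x-m+1)/m!$. $a_n\sim b_n$ means $a_n/b_n\to1$ as $n\to\infty$. *)

theory Defs
  imports "HOL-Probability.Probability" "HOL-Library.Landau_Symbols"
begin

(* A choice of indices i_1 < ... < i_k in {1..n} is the list [i_1, ..., i_k]. *)
definition weakly_incr_subseqs :: "(nat \<Rightarrow> nat) \<Rightarrow> nat \<Rightarrow> nat \<Rightarrow> nat" where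
  "weakly_incr_subseqs x n k =
     (\<Sum>js | length js = k \<and> sorted_wrt (<) js \<and> set js \<subseteq> {1..n}. of_bool (sorted (map x js)))"

definition Y :: "(nat \<Rightarrow> 'b \<Rightarrow> nat) \<Rightarrow> nat \<Rightarrow> nat \<Rightarrow> 'b \<Rightarrow> real" where
  "Y X n k \<omega> = real (weakly_incr_subseqs (\<lambda>i. X i \<omega>) n k)"

(* The subtractions on nat below do not truncate for 1 <= k and 1 <= a,
   by the range of s. *)
definition C :: "nat \<Rightarrow> nat \<Rightarrow> real" where
  "C k a = 1 / real a ^ (2 * k) *
     (real a / fact (2 * k - 1) *
        (\<Sum>s = 0..min (a - 1) (k - 1).
           4 ^ s * (fact (2 * k + a - s - 2) /
             (fact (2 * s + 1) * fact (a - s - 1) * (fact (k - s - 1))\<^sup>2)))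
      - 1 / (fact (k - 1))\<^sup>2 * ((real k + real a - 1) gchoose k)\<^sup>2)"

end

theory Submission
  imports Defs
begin

text \<open>
The second moment counts triples of a word \<open>w\<close> and two \<open>k\<close>-subsets \<open>I\<close>, \<open>J\<close> of its positions along
both of which \<open>w\<close> increases weakly. If \<open>I\<close> and \<open>J\<close> share \<open>t\<close> positions, their union has
\<open>2 * k - t\<close> positions; these can be chosen in \<open>n choose (2 * k - t)\<close> ways, and what remains is the number
\<open>N\<^sub>t\<close> of such triples in which \<open>I\<close> and \<open>J\<close> cover the word. Deleting the last letter of a word
turns this into a recursion (\<open>word_sum_eq\<close>, \<open>covering_pairs\<close>).

The \<open>t\<close> common letters of a covering triple cut the word into \<open>t + 1\<close> segments. A segment whose letters
range over \<open>d + 1\<close> values and which has \<open>p\<close> letters of \<open>I\<close> and \<open>q\<close> letters of \<open>J\<close> can be filled in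
\<open>((p + q) choose p) * ((p + d) choose p) * ((q + d) choose q)\<close> ways, and the generating function of these
numbers in \<open>x\<close>, \<open>y\<close>, \<open>z\<close> (marking \<open>p\<close>, \<open>q\<close>, \<open>d\<close>) is \<open>((1 - x - y - z)\<^sup>2 - 4 * x * y * z)\<close> to the
power \<open>-1/2\<close>. So \<open>N\<^sub>t\<close> is the coefficient of \<open>x ^ (k - t) * y ^ (k - t) * z ^ (a - 1)\<close> in the
\<open>(t + 1)\<close>-st power of that function, and the binomial expansion in \<open>4 * x * y * z / (1 - x - y - z)\<^sup>2\<close>
gives the sum over \<open>s\<close> (\<open>overlap_gf_power\<close>, \<open>overlap_gf_nth\<close>, \<open>covering_pairs_diagonal\<close>). That the
square root has the product coefficients is a Saalschuetz-type binomial identity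
(\<open>sum_choose_choose_choose\<close>); the additivity of exponents is Vandermonde's identity.

Both the second moment and the squared mean are now polynomials in \<open>n\<close> of degree \<open>2 * k\<close>. The term \<open>t = 0\<close>
gives the asymptotics of the second moment. In the variance the leading terms cancel; the coefficient of
\<open>n ^ (2 * k - 1)\<close> collects \<open>t = 1\<close> and the second-order terms of \<open>n choose (2 * k)\<close> and
\<open>(n choose k)\<^sup>2\<close>, which yields \<open>C k a\<close> (\<open>variance_leading_term\<close>, \<open>C_eq\<close>).

The limit of the variance divided by \<open>n ^ (2 * k - 1)\<close> gives an asymptotic equivalence only if it is not zero. For
\<open>k = 1\<close> the variance and \<open>C k a\<close> both vanish. For \<open>k \<ge> 2\<close>, Beta integrals turn \<open>C k a\<close> into the variance of the function
\<open>h c x = (\<Sum>i<k. ((i + c) choose i) * ((k - 1 - i + (a - 1 - c)) choose (k - 1 - i)) * x ^ i * (1 - x) ^ (k - 1 - i)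
/ (fact i * fact (k - 1 - i)))\<close> of a uniform letter \<open>c < a\<close> and a uniform position \<open>x \<in> [0, 1]\<close>, up to a positive
factor. It is positive because \<open>h\<close> is not constant (\<open>single_overlap_gt\<close>). Up to scaling,
\<open>h c x\<close> is the asymptotic expected number of weakly increasing subsequences of length \<open>k\<close> through a letter \<open>c + 1\<close> at
relative position \<open>x\<close>.
\<close>

unbundle no vec_syntax
unbundle fps_syntax

section \<open>A Saalschuetz-type binomial identity\<close>

text \<open>
For fixed \<open>p\<close> both sides are polynomials in \<open>d\<close>, and the right-hand side acquires the factor
\<open>(d + q + 1) / (q + 1)\<close> when \<open>q\<close> grows by one. In the basis of the polynomials
\<open>(p + q + d - s) choose (p + q)\<close>, multiplication by \<open>d + q + 1\<close> only mixes the neighbours \<open>s\<close> and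
\<open>s + 1\<close> (step \<open>multiply\<close>), so the induction on \<open>q\<close> reduces to Pascal's rule for the coefficients.
\<close>
lemma sum_choose_choose_choose:
  fixes p q d :: nat
  shows "(\<Sum>s\<le>p. (p choose s) * (q choose s) * ((p + q + d - s) choose (p + q)))
    = ((p + d) choose p) * ((q + d) choose q)"
proof (induction q)
  case 0
  have "(\<Sum>s\<le>p. (p choose s) * (0 choose s) * ((p + 0 + d - s) choose (p + 0)))
      = (\<Sum>s\<in>{0}. (p choose s) * (0 choose s) * ((p + 0 + d - s) choose (p + 0)))"
    by (rule sum.mono_neutral_right) (auto simp: binomial_eq_0)
  then show ?case by simp
next
  case (Suc q)
  define T where "T s = real ((p + q + 1 + d - s) choose (p + q + 1))" for s
  define U where "U s = real (p choose s) * real (q choose s)" for s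
  have multiply: "real (d + q + 1) * real ((p + q + d - s) choose (p + q))
      = real (q + 1 + s) * T s + real (p - s) * T (Suc s)" if "s \<le> p" for s
  proof -
    define N where "N = p + q + d - s"
    have N: "real N = real p + real q + real d - real s"
      using that by (simp add: N_def)
    have T: "T s = real (N choose (p + q)) + real (N choose Suc (p + q))"
      "T (Suc s) = real (N choose Suc (p + q))"
    proof -
      have "p + q + 1 + d - s = Suc N" "p + q + 1 + d - Suc s = N"
        using that by (auto simp: N_def)
      then show "T s = real (N choose (p + q)) + real (N choose Suc (p + q))"
        "T (Suc s) = real (N choose Suc (p + q))"
        by (simp_all add: T_def)
    qed
    have "real (Suc (p + q)) * (real (N choose (p + q)) + real (N choose Suc (p + q)))
        = real (Suc N) * real (N choose (p + q))"
      using Suc_times_binomial_eq[of N "p + q"]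
      by (metis binomial_Suc_Suc of_nat_add of_nat_mult mult.commute)
    then show ?thesis
      unfolding T N_def[symmetric] using N that by (simp add: algebra_simps of_nat_diff)
  qed
  \<comment> \<open>Shift \<open>s\<close> by one, using \<open>(p choose s) * (p - s) = (s + 1) * (p choose (s + 1))\<close>.\<close>
  have shift: "(\<Sum>s\<le>p. U s * (real (p - s) * T (Suc s)))
      = (\<Sum>s\<le>p. real s * real (p choose s) * real (q choose (s - 1)) * T s)"
  proof -
    have "(\<Sum>s\<le>p. U s * (real (p - s) * T (Suc s)))
        = (\<Sum>s\<le>p. real (Suc s) * real (p choose Suc s) * real (q choose s) * T (Suc s))"
    proof (rule sum.cong[OF refl])
      fix s assume "s \<in> {..p}"
      have "real (p choose s) * real (p - s) = real (Suc s) * real (p choose Suc s)"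
        using binomial_absorb_comp[of p s] binomial_absorption[of s p]
        by (metis of_nat_mult mult.commute)
      moreover have "U s * (real (p - s) * T (Suc s))
          = real (p choose s) * real (p - s) * real (q choose s) * T (Suc s)"
        by (simp add: U_def)
      ultimately show "U s * (real (p - s) * T (Suc s))
          = real (Suc s) * real (p choose Suc s) * real (q choose s) * T (Suc s)"
        by simp
    qed
    also have "\<dots> = (\<Sum>s\<le>Suc p. real s * real (p choose s) * real (q choose (s - 1)) * T s)"
      by (subst sum.atMost_Suc_shift) simp
    finally show ?thesis by simp
  qed
  have pascal: "real (q + 1 + s) * real (q choose s) + real s * real (q choose (s - 1))
      = real (Suc q) * real (Suc q choose s)" for s
  proof (cases s)
    case (Suc r)
    have "real (Suc r) * (real (q choose r) + real (q choose Suc r)) = real (Suc q) * real (q choose r)"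
      using Suc_times_binomial_eq[of q r]
      by (metis binomial_Suc_Suc of_nat_add of_nat_mult mult.commute)
    then show ?thesis by (simp add: Suc algebra_simps)
  qed simp
  have "real (Suc q) * (\<Sum>s\<le>p. real (p choose s) * real (Suc q choose s) * T s)
      = (\<Sum>s\<le>p. U s * (real (q + 1 + s) * T s))
        + (\<Sum>s\<le>p. real s * real (p choose s) * real (q choose (s - 1)) * T s)"
    unfolding sum_distrib_left sum.distrib[symmetric]
  proof (rule sum.cong[OF refl])
    fix s
    have "real (Suc q) * (real (p choose s) * real (Suc q choose s) * T s)
      = real (p choose s) * T s * (real (Suc q) * real (Suc q choose s))"
      by (simp only: mult_ac)
    then show "real (Suc q) * (real (p choose s) * real (Suc q choose s) * T s)
      = U s * (real (q + 1 + s) * T s) + real s * real (p choose s) * real (q choose (s - 1)) * T s"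
      unfolding pascal[symmetric] U_def by (simp add: algebra_simps)
  qed
  also have "\<dots> = (\<Sum>s\<le>p. U s * (real (d + q + 1) * real ((p + q + d - s) choose (p + q))))"
    unfolding shift[symmetric] sum.distrib[symmetric]
    by (rule sum.cong[OF refl]) (simp only: atMost_iff multiply distrib_left)
  also have "\<dots> = real (d + q + 1) * real (((p + d) choose p) * ((q + d) choose q))"
    unfolding Suc[symmetric] U_def by (simp add: sum_distrib_left mult_ac)
  also have "\<dots> = real (Suc q) * real (((p + d) choose p) * ((Suc q + d) choose Suc q))"
    using Suc_times_binomial_eq[of "q + d" q]
    by (metis (no_types, opaque_lifting) Suc_eq_plus1 add.commute add_Suc_right add_Suc mult.assoc mult.commute of_nat_mult)
  finally have "(\<Sum>s\<le>p. real (p choose s) * real (Suc q choose s) * T s)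
      = real (((p + d) choose p) * ((Suc q + d) choose Suc q))"
    by (metis mult_left_cancel of_nat_eq_0_iff nat.distinct(1))
  then have "real (\<Sum>s\<le>p. (p choose s) * (Suc q choose s) * ((p + Suc q + d - s) choose (p + Suc q)))
      = real (((p + d) choose p) * ((Suc q + d) choose Suc q))"
    by (simp add: T_def)
  then show ?case by (simp only: of_nat_eq_iff)
qed

section \<open>Powers of the segment generating function\<close>

text \<open>
The series \<open>v / (1 - v * X)\<close>, that is, the inverse of \<open>w - X\<close> if \<open>v\<close> is the inverse of \<open>w\<close>. Nesting it
inverts \<open>1 - x - y - z\<close> one variable at a time.
\<close>
definition geom :: "'a::comm_ring_1 \<Rightarrow> 'a fps" where
  "geom v = Abs_fps (\<lambda>d. v ^ Suc d)"

lemma geom_power_nth: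
  "(geom v ^ Suc n) $ d = of_nat ((n + d) choose d) * v ^ (n + d + 1)"
proof (induction n arbitrary: d)
  case 0
  then show ?case by (simp add: geom_def)
next
  case (Suc n)
  have "(geom v ^ Suc (Suc n)) $ d = (\<Sum>i=0..d. (geom v ^ Suc n) $ i * geom v $ (d - i))"
    by (subst power_Suc2) (simp only: fps_mult_nth)
  also have "\<dots> = (\<Sum>i\<le>d. of_nat ((n + i) choose i) * v ^ (Suc n + d + 1))"
  proof (rule sum.cong)
    fix i assume "i \<in> {..d}"
    then have "n + i + 1 + Suc (d - i) = Suc n + d + 1" by simp
    then have "v ^ (n + i + 1) * v ^ Suc (d - i) = v ^ (Suc n + d + 1)"
      by (metis power_add)
    then show "(geom v ^ Suc n) $ i * geom v $ (d - i)
        = of_nat ((n + i) choose i) * v ^ (Suc n + d + 1)"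
      unfolding Suc.IH by (simp only: geom_def fps_nth_Abs_fps mult.assoc)
  qed auto
  also have "\<dots> = of_nat (\<Sum>i\<le>d. ((n + i) choose i)) * v ^ (Suc n + d + 1)"
    by (simp add: sum_distrib_right)
  also have "(\<Sum>i\<le>d. ((n + i) choose i)) = (Suc n + d) choose d"
    by (simp add: sum_choose_lower)
  finally show ?case .
qed

text \<open>
The inverse of \<open>1 - x - y - z\<close> as a series in \<open>z\<close> over series in \<open>x\<close> over series in \<open>y\<close>; hence
coefficients are read off as \<open>F $ d $ p $ q\<close>, with \<open>d\<close> the exponent of \<open>z\<close>.
\<close>
definition trinomial_gf :: "real fps fps fps" where
  "trinomial_gf = geom (geom (geom 1))"

lemma trinomial_gf_power_nth:
  "(trinomial_gf ^ Suc n) $ d $ p $ q = fact (n + d + p + q) / (fact n * fact d * fact p * fact q)"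
proof -
  have "(trinomial_gf ^ Suc n) $ d $ p $ q
      = real ((n + d) choose d) * real ((n + d + p) choose p) * real ((n + d + p + q) choose q)"
    by (simp only: trinomial_gf_def geom_power_nth fps_mult_of_nat_nth Suc_eq_plus1[symmetric] power_one
        mult.assoc mult_1_right)
  then show ?thesis by (simp add: binomial_fact)
qed

definition xyz :: "real fps fps fps" where
  "xyz = fps_X * fps_const (fps_X * fps_const fps_X)"

lemma xyz_power_mult_nth:
  "(xyz ^ s * F) $ d $ p $ q
    = (if s \<le> d \<and> s \<le> p \<and> s \<le> q then F $ (d - s) $ (p - s) $ (q - s) else 0)"
proof -
  have eq: "xyz ^ s * F = fps_X ^ s * (fps_const (fps_X ^ s * fps_const (fps_X ^ s)) * F)"
    by (simp add: xyz_def power_mult_distrib mult.assoc)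
  show ?thesis
    unfolding eq by (simp add: fps_X_power_mult_nth mult.assoc)
qed

text \<open>
A coefficient of \<open>A * (B oo U)\<close> is the finite sum obtained by expanding \<open>B oo U\<close> as \<open>\<Sum>s. B $ s * U ^ s\<close>,
since \<open>U ^ s\<close> starts at degree \<open>s\<close>.
\<close>
lemma fps_mult_compose_nth:
  fixes A B U :: "'a::idom fps"
  assumes "U $ 0 = 0"
  shows "(A * (B oo U)) $ d = (\<Sum>s\<le>d. B $ s * (U ^ s * A) $ d)"
proof -
  have "(A * (B oo U)) $ d = (\<Sum>i=0..d. A $ i * (\<Sum>s\<le>d. B $ s * U ^ s $ (d - i)))"
    unfolding fps_mult_nth fps_compose_nth
  proof (rule sum.cong[OF refl], rule arg_cong2[where f = "(*)", OF refl])
    fix i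
    show "(\<Sum>s = 0..d - i. B $ s * U ^ s $ (d - i)) = (\<Sum>s\<le>d. B $ s * U ^ s $ (d - i))"
      using startsby_zero_power_prefix[OF assms]
      by (intro sum.mono_neutral_left) auto
  qed
  also have "\<dots> = (\<Sum>s\<le>d. \<Sum>i=0..d. A $ i * (B $ s * U ^ s $ (d - i)))"
    unfolding sum_distrib_left by (rule sum.swap)
  also have "\<dots> = (\<Sum>s\<le>d. B $ s * (A * U ^ s) $ d)"
    by (simp add: fps_mult_nth sum_distrib_left mult_ac)
  finally show ?thesis by (simp add: mult.commute)
qed

text \<open>
The coefficients of \<open>(1 - 4 * u)\<close> to the power \<open>- (t + 1) / 2\<close>.
\<close>
definition root_coeff :: "nat \<Rightarrow> nat \<Rightarrow> real" where
  "root_coeff t s = 4 ^ s * ((real s + (real t + 1) / 2 - 1) gchoose s)"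

lemma root_coeff_eq: "root_coeff t s = (- 4) ^ s * ((- ((real t + 1) / 2)) gchoose s)"
proof -
  have "(- 4 :: real) ^ s * (- 1) ^ s = 4 ^ s"
    by (simp only: power_mult_distrib[symmetric]) simp
  moreover have "(real t + 1) / 2 + real s - 1 = real s + (real t + 1) / 2 - 1" by simp
  ultimately show ?thesis
    unfolding root_coeff_def gbinomial_minus by (metis mult.assoc)
qed

lemma root_coeff_Vandermonde:
  "(\<Sum>i=0..s. root_coeff t i * root_coeff u (s - i)) = root_coeff (Suc (t + u)) s"
proof -
  have "(\<Sum>i=0..s. root_coeff t i * root_coeff u (s - i))
      = (\<Sum>i=0..s. (- 4) ^ s * (((- ((real t + 1) / 2)) gchoose i)
           * ((- ((real u + 1) / 2)) gchoose (s - i))))"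
  proof (rule sum.cong[OF refl])
    fix i assume "i \<in> {0..s}"
    then have "(- 4 :: real) ^ s = (- 4) ^ i * (- 4) ^ (s - i)"
      by (simp flip: power_add)
    then show "root_coeff t i * root_coeff u (s - i)
      = (- 4) ^ s * (((- ((real t + 1) / 2)) gchoose i) * ((- ((real u + 1) / 2)) gchoose (s - i)))"
      by (simp add: root_coeff_eq)
  qed
  also have "\<dots> = (- 4) ^ s * ((- ((real t + 1) / 2) + - ((real u + 1) / 2)) gchoose s)"
    unfolding gbinomial_Vandermonde[symmetric] by (simp only: sum_distrib_left)
  also have "- ((real t + 1) / 2) + - ((real u + 1) / 2) = - ((real (Suc (t + u)) + 1) / 2)"
    by (simp add: field_simps)
  finally show ?thesis by (simp only: root_coeff_eq)
qed

definition root_gf :: "nat \<Rightarrow> real fps fps fps" where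
  "root_gf t = Abs_fps (\<lambda>s. fps_const (fps_const (root_coeff t s)))"

lemma root_gf_Suc: "root_gf t * root_gf 0 = root_gf (Suc t)"
proof (rule fps_ext)
  fix s
  have "(root_gf t * root_gf 0) $ s
      = (\<Sum>i=0..s. fps_const (fps_const (root_coeff t i * root_coeff 0 (s - i))))"
    by (simp add: fps_mult_nth root_gf_def)
  also have "\<dots> = fps_const (fps_const (\<Sum>i=0..s. root_coeff t i * root_coeff 0 (s - i)))"
    by (induction s) (simp_all add: fps_eq_iff fps_sum_nth)
  finally show "(root_gf t * root_gf 0) $ s = root_gf (Suc t) $ s"
    by (simp add: root_coeff_Vandermonde root_gf_def)
qed

lemma root_gf_power: "root_gf 0 ^ Suc t = root_gf t"
proof (induction t)
  case (Suc t)
  have "root_gf 0 ^ Suc (Suc t) = root_gf 0 ^ Suc t * root_gf 0" by (rule power_Suc2)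
  then show ?case by (simp only: Suc root_gf_Suc)
qed simp

text \<open>
This is \<open>((1 - x - y - z)\<^sup>2 - 4 * x * y * z)\<close> to the power \<open>- (t + 1) / 2\<close>, with
\<open>(1 - x - y - z) ^ (t + 1)\<close> taken out of the root. Defining it for every \<open>t\<close> by its binomial expansion avoids
square roots of power series; that it is a power of \<open>overlap_gf 0\<close> is then a theorem.
\<close>
definition overlap_gf :: "nat \<Rightarrow> real fps fps fps" where
  "overlap_gf t = trinomial_gf ^ Suc t * (root_gf t oo (xyz * trinomial_gf\<^sup>2))"

lemma overlap_gf_power: "overlap_gf 0 ^ Suc t = overlap_gf t"
proof -
  have U0: "(xyz * trinomial_gf\<^sup>2) $ 0 = 0" by (simp add: xyz_def)
  have "(root_gf 0 oo (xyz * trinomial_gf\<^sup>2)) ^ Suc t = root_gf t oo (xyz * trinomial_gf\<^sup>2)"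
    using fps_compose_power[OF U0, of "root_gf 0" "Suc t"] by (simp only: root_gf_power)
  then show ?thesis by (simp add: overlap_gf_def power_mult_distrib)
qed

definition overlap_coeff :: "nat \<Rightarrow> nat \<Rightarrow> nat \<Rightarrow> nat \<Rightarrow> real" where
  "overlap_coeff t p q d = (\<Sum>s\<le>min d (min p q). root_coeff t s *
     (fact (p + q + d + t - s) / (fact (t + 2 * s) * fact (p - s) * fact (q - s) * fact (d - s))))"

lemma overlap_gf_nth: "overlap_gf t $ d $ p $ q = overlap_coeff t p q d"
proof -
  have U0: "(xyz * trinomial_gf\<^sup>2) $ 0 = 0" by (simp add: xyz_def)
  have "(xyz * trinomial_gf\<^sup>2) ^ s * trinomial_gf ^ Suc t = xyz ^ s * trinomial_gf ^ Suc (t + 2 * s)" for s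
  proof -
    have "(trinomial_gf\<^sup>2) ^ s * trinomial_gf ^ Suc t = trinomial_gf ^ Suc (t + 2 * s)"
      by (simp only: power_mult[symmetric] power_add[symmetric]) (simp add: add.commute)
    then show ?thesis
      by (simp only: power_mult_distrib mult.assoc)
  qed
  then have "overlap_gf t $ d = (\<Sum>s\<le>d. fps_const (fps_const (root_coeff t s)) * (xyz ^ s * trinomial_gf ^ Suc (t + 2 * s)) $ d)"
    unfolding overlap_gf_def fps_mult_compose_nth[OF U0] by (simp only: root_gf_def fps_nth_Abs_fps)
  then have "overlap_gf t $ d $ p $ q
      = (\<Sum>s\<le>d. root_coeff t s * (xyz ^ s * trinomial_gf ^ Suc (t + 2 * s)) $ d $ p $ q)"
    by (simp only: fps_sum_nth fps_mult_left_const_nth)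
  also have "\<dots> = (\<Sum>s\<le>min d (min p q). root_coeff t s * (trinomial_gf ^ Suc (t + 2 * s)) $ (d - s) $ (p - s) $ (q - s))"
    unfolding xyz_power_mult_nth
    by (rule sum.mono_neutral_cong_right) auto
  also have "\<dots> = overlap_coeff t p q d"
    unfolding overlap_coeff_def trinomial_gf_power_nth
  proof (intro sum.cong refl)
    fix s assume "s \<in> {..min d (min p q)}"
    then have "t + 2 * s + (d - s) + (p - s) + (q - s) = p + q + d + t - s" by auto
    then show "root_coeff t s * (fact (t + 2 * s + (d - s) + (p - s) + (q - s))
         / (fact (t + 2 * s) * fact (d - s) * fact (p - s) * fact (q - s)))
      = root_coeff t s * (fact (p + q + d + t - s)
         / (fact (t + 2 * s) * fact (p - s) * fact (q - s) * fact (d - s)))"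
      by (simp only: mult_ac)
  qed
  finally show ?thesis .
qed

text \<open>
The segments between two consecutive common positions: shuffle \<open>p\<close> letters that increase weakly within a
range of \<open>\<alpha> + 1\<close> values with \<open>q\<close> letters that increase weakly within a range of \<open>\<beta> + 1\<close> values. On the
diagonal \<open>\<alpha> = \<beta>\<close> these are the coefficients of \<open>overlap_gf 0\<close>; the general case is needed for recursions
that lower one of the two ranges at a time.
\<close>
definition shuffle_gf :: "nat \<Rightarrow> nat \<Rightarrow> real fps fps" where
  "shuffle_gf \<alpha> \<beta> = Abs_fps (\<lambda>p. Abs_fps (\<lambda>q.
     real (((p + q) choose p) * ((p + \<alpha>) choose p) * ((q + \<beta>) choose q))))"

text \<open>
These are the central binomial coefficients, whose generating function is \<open>(1 - 4 * u)\<close> to the power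
\<open>-1/2\<close>.
\<close>
lemma root_coeff_0: "root_coeff 0 s = fact (2 * s) / (fact s)\<^sup>2"
proof (induction s)
  case 0
  then show ?case by (simp add: root_coeff_def)
next
  case (Suc s)
  have "root_coeff 0 (Suc s) = 4 * (root_coeff 0 s * ((real s + 1 / 2) / (real s + 1)))"
    using gbinomial_rec[of "real s - 1 / 2" s]
    by (simp add: root_coeff_def algebra_simps)
  also have "\<dots> = (2 * real s + 2) * (2 * real s + 1) * fact (2 * s) / ((real s + 1) * fact s)\<^sup>2"
    unfolding Suc by (simp add: divide_simps power2_eq_square) (simp add: algebra_simps)
  also have "(2 * real s + 2) * (2 * real s + 1) * fact (2 * s) = fact (2 * Suc s)"
    by (simp add: algebra_simps)
  also have "(real s + 1) * fact s = fact (Suc s)"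
    by (simp add: algebra_simps)
  finally show ?case .
qed

text \<open>
Dividing the summand for \<open>s\<close> by \<open>(p + q) choose p\<close> leaves the product of three binomial coefficients summed
in \<open>sum_choose_choose_choose\<close>.
\<close>
lemma overlap_coeff_0:
  "overlap_coeff 0 p q d = real (((p + q) choose p) * ((p + d) choose p) * ((q + d) choose q))"
proof -
  have "overlap_coeff 0 p q d = (\<Sum>s\<le>min d (min p q). real ((p + q) choose p) *
     real ((p choose s) * (q choose s) * ((p + q + d - s) choose (p + q))))"
    unfolding overlap_coeff_def
  proof (intro sum.cong refl)
    fix s assume "s \<in> {..min d (min p q)}"
    then have s: "s \<le> p" "s \<le> q" "s \<le> d" "p + q \<le> p + q + d - s" "p + q + d - s - (p + q) = d - s"
      by auto
    show "root_coeff 0 s * (fact (p + q + d + 0 - s)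
         / (fact (0 + 2 * s) * fact (p - s) * fact (q - s) * fact (d - s)))
      = real ((p + q) choose p) * real ((p choose s) * (q choose s) * ((p + q + d - s) choose (p + q)))"
    proof -
      have cancel: "e / s2\<^sup>2 * (f / (e * ps * qs * ds))
          = pq / (pp * qq) * (pp / (s2 * ps) * (qq / (s2 * qs)) * (f / (pq * ds)))"
        if "e \<noteq> 0" "s2 \<noteq> 0" "pq \<noteq> 0" "pp \<noteq> 0" "qq \<noteq> 0" for e s2 f ps qs ds pq pp qq :: real
        using that by (simp add: power2_eq_square)
      have "real ((p + q) choose p) = fact (p + q) / (fact p * fact q)"
        "real (p choose s) = fact p / (fact s * fact (p - s))"
        "real (q choose s) = fact q / (fact s * fact (q - s))"
        "real ((p + q + d - s) choose (p + q)) = fact (p + q + d - s) / (fact (p + q) * fact (d - s))"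
        using s by (simp_all only: binomial_fact) simp_all
      then show ?thesis
        unfolding root_coeff_0 of_nat_mult add_0 add_0_right
        by (simp only: cancel[OF fact_nonzero fact_nonzero fact_nonzero fact_nonzero fact_nonzero])
    qed
  qed
  also have "\<dots> = (\<Sum>s\<le>p. real ((p + q) choose p) *
     real ((p choose s) * (q choose s) * ((p + q + d - s) choose (p + q))))"
    by (rule sum.mono_neutral_left) (auto simp: not_le binomial_eq_0)
  also have "\<dots> = real ((p + q) choose p)
      * real (\<Sum>s\<le>p. (p choose s) * (q choose s) * ((p + q + d - s) choose (p + q)))"
    by (simp only: of_nat_sum sum_distrib_left)
  also have "\<dots> = real ((p + q) choose p) * real (((p + d) choose p) * ((q + d) choose q))"
    by (simp only: sum_choose_choose_choose)
  finally show ?thesis by simp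
qed

lemma overlap_gf_0_nth: "overlap_gf 0 $ d = shuffle_gf d d"
  by (intro fps_ext) (simp only: overlap_gf_nth overlap_coeff_0 shuffle_gf_def fps_nth_Abs_fps)

section \<open>Pairs of increasing subsequences in words\<close>

text \<open>
The number of words of length \<open>m\<close> with two weakly increasing subsequences of lengths \<open>k\<close> and \<open>l\<close> that
together use all positions, where the first uses letters up to \<open>\<alpha> + 1\<close> and the second letters up to
\<open>\<beta> + 1\<close>. The three summands are the cases in which the last letter, of value \<open>c + 1\<close>, lies in the first
subsequence only, in the second only, or in both; it becomes the new bound of each subsequence that used it.
\<close>
fun covering_pairs :: "nat \<Rightarrow> nat \<Rightarrow> nat \<Rightarrow> nat \<Rightarrow> nat \<Rightarrow> real" where
  "covering_pairs 0 k l \<alpha> \<beta> = of_bool (k = 0 \<and> l = 0)"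
| "covering_pairs (Suc m) k l \<alpha> \<beta> =
     (if k = 0 then 0 else \<Sum>c\<le>\<alpha>. covering_pairs m (k - 1) l c \<beta>)
     + (if l = 0 then 0 else \<Sum>c\<le>\<beta>. covering_pairs m k (l - 1) \<alpha> c)
     + (if k = 0 \<or> l = 0 then 0 else \<Sum>c\<le>min \<alpha> \<beta>. covering_pairs m (k - 1) (l - 1) c c)"

lemma covering_pairs_eq_0:
  "m < k \<or> m < l \<or> k + l < m \<Longrightarrow> covering_pairs m k l \<alpha> \<beta> = 0"
proof (induction m arbitrary: k l \<alpha> \<beta>)
  case (Suc m)
  have "covering_pairs m (k - 1) l c d = 0" if "k \<noteq> 0" for c d
    using Suc.prems that by (intro Suc.IH) auto
  moreover have "covering_pairs m k (l - 1) c d = 0" if "l \<noteq> 0" for c d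
    using Suc.prems that by (intro Suc.IH) auto
  moreover have "covering_pairs m (k - 1) (l - 1) c d = 0" if "k \<noteq> 0" "l \<noteq> 0" for c d
    using Suc.prems that by (intro Suc.IH) auto
  ultimately show ?case by (cases "k = 0"; cases "l = 0") simp_all
qed auto

definition index_lists :: "nat \<Rightarrow> nat \<Rightarrow> nat list set" where
  "index_lists n k = {js. length js = k \<and> sorted_wrt (<) js \<and> set js \<subseteq> {1..n}}"

lemma finite_index_lists: "finite (index_lists n k)"
  by (rule finite_subset[OF _ finite_lists_length_eq[of "{1..n}" k]])
     (auto simp: index_lists_def)

lemma index_lists_Suc_Suc:
  "index_lists (Suc n) (Suc k)
    = index_lists n (Suc k) \<union> (\<lambda>js. js @ [Suc n]) ` index_lists n k"
proof (intro subset_antisym subsetI)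
  fix js assume js: "js \<in> index_lists (Suc n) (Suc k)"
  then obtain ks j where ks: "js = ks @ [j]"
    by (cases js rule: rev_cases) (auto simp: index_lists_def)
  have props: "length ks = k" "sorted_wrt (<) ks" "\<forall>i\<in>set ks. 1 \<le> i \<and> i < j" "1 \<le> j" "j \<le> Suc n"
    using js by (auto simp: ks index_lists_def sorted_wrt_append)
  show "js \<in> index_lists n (Suc k) \<union> (\<lambda>js. js @ [Suc n]) ` index_lists n k"
  proof (cases "j = Suc n")
    case True
    then have "ks \<in> index_lists n k" using props by (fastforce simp: index_lists_def)
    then show ?thesis using True ks by blast
  next
    case False
    then have "js \<in> index_lists n (Suc k)"
      using props js by (fastforce simp: index_lists_def ks)
    then show ?thesis by blast
  qed
next
  fix js assume "js \<in> index_lists n (Suc k) \<union> (\<lambda>js. js @ [Suc n]) ` index_lists n k"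
  then show "js \<in> index_lists (Suc n) (Suc k)"
    by (fastforce simp: index_lists_def sorted_wrt_append)
qed

text \<open>
Bounding the letters by \<open>u\<close> makes the count recursive in \<open>n\<close>: if the last position is used, its letter bounds
the letters before it.
\<close>
definition bounded_incr :: "(nat \<Rightarrow> nat) \<Rightarrow> nat \<Rightarrow> nat \<Rightarrow> nat \<Rightarrow> nat" where
  "bounded_incr x n k u =
     (\<Sum>js\<in>index_lists n k. of_bool (sorted (map x js) \<and> (\<forall>j\<in>set js. x j \<le> u)))"

lemma bounded_incr_cong:
  assumes "\<And>i. i \<in> {1..n} \<Longrightarrow> x i = y i"
  shows "bounded_incr x n k u = bounded_incr y n k u"
  unfolding bounded_incr_def
proof (rule sum.cong[OF refl])
  fix js assume "js \<in> index_lists n k"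
  then have eq: "\<And>i. i \<in> set js \<Longrightarrow> x i = y i"
    using assms by (auto simp: index_lists_def)
  then have m: "map x js = map y js" by simp
  have b: "(\<forall>j\<in>set js. x j \<le> u) = (\<forall>j\<in>set js. y j \<le> u)"
    using eq by auto
  show "(of_bool (sorted (map x js) \<and> (\<forall>j\<in>set js. x j \<le> u)) :: nat)
      = of_bool (sorted (map y js) \<and> (\<forall>j\<in>set js. y j \<le> u))"
    unfolding m b ..
qed

lemma weakly_incr_subseqs_eq_bounded_incr:
  assumes "\<And>i. i \<in> {1..n} \<Longrightarrow> x i \<le> u"
  shows "weakly_incr_subseqs x n k = bounded_incr x n k u"
  unfolding weakly_incr_subseqs_def bounded_incr_def index_lists_def
  by (rule sum.cong[OF refl]) (use assms in fastforce)

lemma bounded_incr_0: "bounded_incr x n 0 u = 1"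
proof -
  have "index_lists n 0 = {[]}" by (auto simp: index_lists_def)
  then show ?thesis by (simp add: bounded_incr_def)
qed

lemma bounded_incr_empty: "bounded_incr x 0 k u = of_bool (k = 0)"
proof (cases "k = 0")
  case False
  then have "index_lists 0 k = {}" by (auto simp: index_lists_def)
  then show ?thesis using False by (simp add: bounded_incr_def)
qed (simp add: bounded_incr_0)

lemma bounded_incr_Suc:
  "bounded_incr x (Suc n) k u = bounded_incr x n k u
     + (if k \<noteq> 0 \<and> x (Suc n) \<le> u then bounded_incr x n (k - 1) (x (Suc n)) else 0)"
proof (cases k)
  case 0
  then show ?thesis by (simp add: bounded_incr_0)
next
  case (Suc k')
  let ?P = "\<lambda>js. of_bool (sorted (map x js) \<and> (\<forall>j\<in>set js. x j \<le> u)) :: nat"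
  have disj: "index_lists n (Suc k') \<inter> (\<lambda>js. js @ [Suc n]) ` index_lists n k' = {}"
    by (auto simp: index_lists_def)
  have "bounded_incr x (Suc n) k u
      = bounded_incr x n k u + (\<Sum>js\<in>(\<lambda>js. js @ [Suc n]) ` index_lists n k'. ?P js)"
    unfolding bounded_incr_def Suc index_lists_Suc_Suc
    by (rule sum.union_disjoint) (auto simp: finite_index_lists disj)
  also have "(\<Sum>js\<in>(\<lambda>js. js @ [Suc n]) ` index_lists n k'. ?P js)
      = (\<Sum>js\<in>index_lists n k'. ?P (js @ [Suc n]))"
    by (subst sum.reindex) (auto simp: inj_on_def)
  also have "\<dots> = (\<Sum>js\<in>index_lists n k'. if x (Suc n) \<le> u then
      of_bool (sorted (map x js) \<and> (\<forall>j\<in>set js. x j \<le> x (Suc n))) else 0)"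
    by (rule sum.cong[OF refl]) (auto simp: sorted_append)
  also have "\<dots> = (if x (Suc n) \<le> u then bounded_incr x n k' (x (Suc n)) else 0)"
    by (simp add: bounded_incr_def)
  finally show ?thesis using Suc by simp
qed

definition word_sum :: "nat \<Rightarrow> nat \<Rightarrow> nat \<Rightarrow> nat \<Rightarrow> nat \<Rightarrow> nat \<Rightarrow> real" where
  "word_sum a n k l \<alpha> \<beta> = (\<Sum>w\<in>PiE {1..n} (\<lambda>_. {1..a}).
     real (bounded_incr w n k (Suc \<alpha>)) * real (bounded_incr w n l (Suc \<beta>)))"

lemma sum_PiE_Suc:
  fixes F :: "(nat \<Rightarrow> nat) \<Rightarrow> real"
  shows "(\<Sum>w\<in>PiE {1..Suc n} (\<lambda>_. A). F w)
    = (\<Sum>w\<in>PiE {1..n} (\<lambda>_. A). \<Sum>c\<in>A. F (w(Suc n := c)))"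
proof -
  have ins: "{1..Suc n} = insert (Suc n) {1..n}" by auto
  have "(\<Sum>w\<in>PiE {1..Suc n} (\<lambda>_. A). F w)
      = (\<Sum>w\<in>(\<lambda>(y, g). g(Suc n := y)) ` (A \<times> PiE {1..n} (\<lambda>_. A)). F w)"
    unfolding ins PiE_insert_eq ..
  also have "\<dots> = (\<Sum>(c, w)\<in>A \<times> PiE {1..n} (\<lambda>_. A). F (w(Suc n := c)))"
    by (subst sum.reindex, rule inj_combinator) (auto simp: case_prod_beta)
  also have "\<dots> = (\<Sum>c\<in>A. \<Sum>w\<in>PiE {1..n} (\<lambda>_. A). F (w(Suc n := c)))"
    by (rule sum.cartesian_product[symmetric])
  also have "\<dots> = (\<Sum>w\<in>PiE {1..n} (\<lambda>_. A). \<Sum>c\<in>A. F (w(Suc n := c)))"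
    by (rule sum.swap)
  finally show ?thesis .
qed

lemma sum_letters_upto:
  fixes h :: "nat \<Rightarrow> real"
  assumes "\<alpha> < a"
  shows "(\<Sum>c\<in>{1..a}. if c \<le> Suc \<alpha> then h c else 0) = (\<Sum>c\<le>\<alpha>. h (Suc c))"
proof -
  have "(\<Sum>c\<in>{1..a}. if c \<le> Suc \<alpha> then h c else 0) = (\<Sum>c\<in>{1..Suc \<alpha>}. h c)"
    using assms by (intro sum.mono_neutral_cong_right) auto
  also have "\<dots> = (\<Sum>c\<le>\<alpha>. h (Suc c))"
    using sum.shift_bounds_cl_Suc_ivl[of h 0 \<alpha>] by (simp add: atMost_atLeast0)
  finally show ?thesis .
qed

text \<open>
Split according to whether the last letter of the word is used by neither subsequence, by the first, by the
second, or by both.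
\<close>
lemma word_sum_Suc:
  assumes "\<alpha> < a" "\<beta> < a"
  shows "word_sum a (Suc n) k l \<alpha> \<beta> = real a * word_sum a n k l \<alpha> \<beta>
     + ((if k = 0 then 0 else \<Sum>c\<le>\<alpha>. word_sum a n (k - 1) l c \<beta>)
     + (if l = 0 then 0 else \<Sum>c\<le>\<beta>. word_sum a n k (l - 1) \<alpha> c)
     + (if k = 0 \<or> l = 0 then 0 else \<Sum>c\<le>min \<alpha> \<beta>. word_sum a n (k - 1) (l - 1) c c))"
proof -
  let ?W = "PiE {1..n} (\<lambda>_. {1..a})"
  let ?b = "\<lambda>w k u. real (bounded_incr w n k u)"
  have letter: "(\<Sum>c\<in>{1..a}. real (bounded_incr (w(Suc n := c)) (Suc n) k (Suc \<alpha>))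
          * real (bounded_incr (w(Suc n := c)) (Suc n) l (Suc \<beta>)))
      = real a * (?b w k (Suc \<alpha>) * ?b w l (Suc \<beta>))
        + ((if k = 0 then 0 else \<Sum>c\<le>\<alpha>. ?b w (k - 1) (Suc c) * ?b w l (Suc \<beta>))
        + (if l = 0 then 0 else \<Sum>c\<le>\<beta>. ?b w k (Suc \<alpha>) * ?b w (l - 1) (Suc c))
        + (if k = 0 \<or> l = 0 then 0 else
             \<Sum>c\<le>min \<alpha> \<beta>. ?b w (k - 1) (Suc c) * ?b w (l - 1) (Suc c)))" for w
  proof -
    have b: "bounded_incr (w(Suc n := c)) n i u = bounded_incr w n i u" for c i u
      by (rule bounded_incr_cong) auto
    have m: "c \<le> Suc (min \<alpha> \<beta>) \<longleftrightarrow> c \<le> Suc \<alpha> \<and> c \<le> Suc \<beta>" for c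
      by auto
    have "(\<Sum>c\<in>{1..a}. real (bounded_incr (w(Suc n := c)) (Suc n) k (Suc \<alpha>))
          * real (bounded_incr (w(Suc n := c)) (Suc n) l (Suc \<beta>)))
      = (\<Sum>c\<in>{1..a}. ?b w k (Suc \<alpha>) * ?b w l (Suc \<beta>)
        + ((if c \<le> Suc \<alpha> then if k = 0 then 0 else ?b w (k - 1) c * ?b w l (Suc \<beta>) else 0)
        + (if c \<le> Suc \<beta> then if l = 0 then 0 else ?b w k (Suc \<alpha>) * ?b w (l - 1) c else 0)
        + (if c \<le> Suc (min \<alpha> \<beta>) then
             if k = 0 \<or> l = 0 then 0 else ?b w (k - 1) c * ?b w (l - 1) c else 0)))"
      by (rule sum.cong[OF refl]) (simp add: bounded_incr_Suc b m algebra_simps)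
    also have "\<dots> = real a * (?b w k (Suc \<alpha>) * ?b w l (Suc \<beta>))
        + ((\<Sum>c\<le>\<alpha>. if k = 0 then 0 else ?b w (k - 1) (Suc c) * ?b w l (Suc \<beta>))
        + (\<Sum>c\<le>\<beta>. if l = 0 then 0 else ?b w k (Suc \<alpha>) * ?b w (l - 1) (Suc c))
        + (\<Sum>c\<le>min \<alpha> \<beta>. if k = 0 \<or> l = 0 then 0 else ?b w (k - 1) (Suc c) * ?b w (l - 1) (Suc c)))"
      unfolding sum.distrib using assms by (subst (1 2 3) sum_letters_upto) simp_all
    finally show ?thesis by simp
  qed
  have "word_sum a (Suc n) k l \<alpha> \<beta>
      = (\<Sum>w\<in>?W. real a * (?b w k (Suc \<alpha>) * ?b w l (Suc \<beta>))
        + ((if k = 0 then 0 else \<Sum>c\<le>\<alpha>. ?b w (k - 1) (Suc c) * ?b w l (Suc \<beta>))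
        + (if l = 0 then 0 else \<Sum>c\<le>\<beta>. ?b w k (Suc \<alpha>) * ?b w (l - 1) (Suc c))
        + (if k = 0 \<or> l = 0 then 0 else
             \<Sum>c\<le>min \<alpha> \<beta>. ?b w (k - 1) (Suc c) * ?b w (l - 1) (Suc c))))"
    unfolding word_sum_def sum_PiE_Suc letter ..
  also have "\<dots> = real a * word_sum a n k l \<alpha> \<beta>
     + ((if k = 0 then 0 else \<Sum>w\<in>?W. \<Sum>c\<le>\<alpha>. ?b w (k - 1) (Suc c) * ?b w l (Suc \<beta>))
     + (if l = 0 then 0 else \<Sum>w\<in>?W. \<Sum>c\<le>\<beta>. ?b w k (Suc \<alpha>) * ?b w (l - 1) (Suc c))
     + (if k = 0 \<or> l = 0 then 0 else
             \<Sum>w\<in>?W. \<Sum>c\<le>min \<alpha> \<beta>. ?b w (k - 1) (Suc c) * ?b w (l - 1) (Suc c)))"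
    unfolding word_sum_def sum.distrib sum_distrib_left by (simp cong: if_cong)
  finally show ?thesis
    unfolding word_sum_def sum.swap[of _ "?W"] .
qed

lemma sum_binomial_Suc:
  fixes f :: "nat \<Rightarrow> real"
  shows "(\<Sum>m\<le>Suc n. real (Suc n choose m) * A ^ (Suc n - m) * f m)
    = A * (\<Sum>m\<le>n. real (n choose m) * A ^ (n - m) * f m)
      + (\<Sum>m\<le>n. real (n choose m) * A ^ (n - m) * f (Suc m))"
proof -
  have "A * (\<Sum>m\<le>n. real (n choose m) * A ^ (n - m) * f m)
      = (\<Sum>m\<le>n. real (n choose m) * A ^ (Suc n - m) * f m)"
    by (simp add: sum_distrib_left Suc_diff_le mult_ac)
  also have "\<dots> = (\<Sum>m\<le>Suc n. real (n choose m) * A ^ (Suc n - m) * f m)"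
    by (simp add: binomial_eq_0)
  also have "\<dots> = A ^ Suc n * f 0 + (\<Sum>m\<le>n. real (n choose Suc m) * A ^ (n - m) * f (Suc m))"
    by (subst sum.atMost_Suc_shift) simp
  finally show ?thesis
    by (subst sum.atMost_Suc_shift) (simp add: sum.distrib[symmetric] algebra_simps)
qed

text \<open>
The positions used by at least one of the two subsequences form an arbitrary set of size \<open>m\<close>, and the letters
outside it are free. In terms of the recursions this is Pascal's rule.
\<close>
lemma word_sum_eq:
  assumes "\<alpha> < a" "\<beta> < a"
  shows "word_sum a n k l \<alpha> \<beta>
    = (\<Sum>m\<le>n. real (n choose m) * real a ^ (n - m) * covering_pairs m k l \<alpha> \<beta>)"
  using assms
proof (induction n arbitrary: k l \<alpha> \<beta>)
  case 0
  then show ?case by (simp add: word_sum_def bounded_incr_empty)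
next
  case (Suc n)
  have IH: "word_sum a n k' l' \<gamma> \<delta>
      = (\<Sum>m\<le>n. real (n choose m) * real a ^ (n - m) * covering_pairs m k' l' \<gamma> \<delta>)"
    if "\<gamma> \<le> \<alpha> \<or> \<gamma> \<le> \<beta>" "\<delta> \<le> \<alpha> \<or> \<delta> \<le> \<beta>" for k' l' \<gamma> \<delta>
    using that Suc.prems by (intro Suc.IH) auto
  have swap: "(\<Sum>c\<le>\<gamma>. \<Sum>m\<le>n. real (n choose m) * real a ^ (n - m) * f m c)
      = (\<Sum>m\<le>n. real (n choose m) * real a ^ (n - m) * (\<Sum>c\<le>\<gamma>. f m c))" for \<gamma> and f :: "nat \<Rightarrow> nat \<Rightarrow> real"
    unfolding sum_distrib_left by (rule sum.swap)
  show ?case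
    unfolding word_sum_Suc[OF Suc.prems] sum_binomial_Suc
    by (simp add: IH swap distrib_left sum.distrib)
qed

section \<open>Generating function of covering pairs\<close>

text \<open>
The sum is over the value \<open>c\<close> of the last of \<open>t\<close> common letters (for \<open>t = 0\<close> only \<open>c = 0\<close> contributes). Up to
that letter both subsequences have the same range, hence the coefficient of \<open>z ^ c\<close> in a power of
\<open>overlap_gf 0\<close>; after it there is one segment whose two ranges may differ.
\<close>
definition covering_gf :: "nat \<Rightarrow> nat \<Rightarrow> nat \<Rightarrow> real fps fps" where
  "covering_gf t \<alpha> \<beta> = (\<Sum>c\<le>min \<alpha> \<beta>. (overlap_gf 0 ^ t) $ c * shuffle_gf (\<alpha> - c) (\<beta> - c))"

text \<open>
A nonempty shuffle ends with a letter of the first or of the second kind, which bounds the earlier letters of its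
kind; the sums over this letter are hockey-stick sums.
\<close>
lemma shuffle_gf_rec:
  "shuffle_gf \<alpha> \<beta> = 1 + fps_X * (\<Sum>c\<le>\<alpha>. shuffle_gf c \<beta>)
     + fps_const fps_X * (\<Sum>c\<le>\<beta>. shuffle_gf \<alpha> c)"
proof (rule fps_ext, rule fps_ext)
  fix p q
  have left: "(\<Sum>c\<le>\<alpha>. real (((p' + q) choose p') * ((p' + c) choose p') * ((q + \<beta>) choose q)))
      = real (((p' + q) choose p') * ((Suc p' + \<alpha>) choose Suc p') * ((q + \<beta>) choose q))" for p'
    using choose_rising_sum(1)[of p' \<alpha>]
    by (simp flip: of_nat_sum sum_distrib_left sum_distrib_right of_nat_mult)
  have right: "(\<Sum>c\<le>\<beta>. real (((p + q') choose p) * ((p + \<alpha>) choose p) * ((q' + c) choose q')))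
      = real (((p + q') choose p) * ((p + \<alpha>) choose p) * ((Suc q' + \<beta>) choose Suc q'))" for q'
    using choose_rising_sum(1)[of q' \<beta>]
    by (simp flip: of_nat_sum sum_distrib_left sum_distrib_right of_nat_mult)
  have "shuffle_gf \<alpha> \<beta> $ p $ q = (if p = 0 \<and> q = 0 then 1 else 0)
      + (if p = 0 then 0 else real (((p - 1 + q) choose (p - 1)) * ((p + \<alpha>) choose p) * ((q + \<beta>) choose q)))
      + (if q = 0 then 0 else real (((p + (q - 1)) choose p) * ((p + \<alpha>) choose p) * ((q + \<beta>) choose q)))"
    by (cases p; cases q) (simp_all add: shuffle_gf_def distrib_left distrib_right binomial_eq_0)
  also have "\<dots> = (if p = 0 \<and> q = 0 then 1 else 0)
      + (if p = 0 then 0 else \<Sum>c\<le>\<alpha>. shuffle_gf c \<beta> $ (p - 1) $ q)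
      + (if q = 0 then 0 else \<Sum>c\<le>\<beta>. shuffle_gf \<alpha> c $ p $ (q - 1))"
  proof -
    have "(\<Sum>c\<le>\<alpha>. shuffle_gf c \<beta> $ (p - 1) $ q)
        = real (((p - 1 + q) choose (p - 1)) * ((p + \<alpha>) choose p) * ((q + \<beta>) choose q))" if "p \<noteq> 0"
      using left[of "p - 1"] that by (simp only: shuffle_gf_def fps_nth_Abs_fps Suc_diff_1 neq0_conv)
    moreover have "(\<Sum>c\<le>\<beta>. shuffle_gf \<alpha> c $ p $ (q - 1))
        = real (((p + (q - 1)) choose p) * ((p + \<alpha>) choose p) * ((q + \<beta>) choose q))" if "q \<noteq> 0"
      using right[of "q - 1"] that by (simp only: shuffle_gf_def fps_nth_Abs_fps Suc_diff_1 neq0_conv)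
    ultimately show ?thesis
      by (cases "p = 0"; cases "q = 0") (simp_all only: if_True if_False simp_thms)
  qed
  also have "\<dots> = (1 + fps_X * (\<Sum>c\<le>\<alpha>. shuffle_gf c \<beta>)
     + fps_const fps_X * (\<Sum>c\<le>\<beta>. shuffle_gf \<alpha> c)) $ p $ q"
    by (simp add: fps_sum_nth)
  finally show "shuffle_gf \<alpha> \<beta> $ p $ q = (1 + fps_X * (\<Sum>c\<le>\<alpha>. shuffle_gf c \<beta>)
     + fps_const fps_X * (\<Sum>c\<le>\<beta>. shuffle_gf \<alpha> c)) $ p $ q" .
qed

lemma sum_diff_swap:
  fixes F :: "nat \<Rightarrow> nat \<Rightarrow> 'a::comm_monoid_add"
  shows "(\<Sum>c\<le>min \<alpha> \<beta>. \<Sum>e\<le>\<alpha> - c. F c e) = (\<Sum>e\<le>\<alpha>. \<Sum>c\<le>min e \<beta>. F c (e - c))"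
proof -
  have "(\<Sum>c\<le>min \<alpha> \<beta>. \<Sum>e\<le>\<alpha> - c. F c e)
      = (\<Sum>(c, e)\<in>(SIGMA c:{..min \<alpha> \<beta>}. {..\<alpha> - c}). F c e)"
    by (rule sum.Sigma) auto
  also have "\<dots> = (\<Sum>(e, c)\<in>(SIGMA e:{..\<alpha>}. {..min e \<beta>}). F c (e - c))"
    by (rule sum.reindex_bij_witness[where i = "\<lambda>(e, c). (c, e - c)" and j = "\<lambda>(c, e). (c + e, c)"])
      auto
  also have "\<dots> = (\<Sum>e\<le>\<alpha>. \<Sum>c\<le>min e \<beta>. F c (e - c))"
    by (rule sum.Sigma[symmetric]) auto
  finally show ?thesis .
qed

lemma covering_gf_rec:
  "covering_gf t \<alpha> \<beta> = (\<Sum>c\<le>min \<alpha> \<beta>. (overlap_gf 0 ^ t) $ c)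
     + fps_X * (\<Sum>c\<le>\<alpha>. covering_gf t c \<beta>) + fps_const fps_X * (\<Sum>c\<le>\<beta>. covering_gf t \<alpha> c)"
proof -
  let ?w = "\<lambda>c. (overlap_gf 0 ^ t) $ c"
  have "covering_gf t \<alpha> \<beta> = (\<Sum>c\<le>min \<alpha> \<beta>. ?w c * (1 + fps_X * (\<Sum>e\<le>\<alpha> - c. shuffle_gf e (\<beta> - c))
     + fps_const fps_X * (\<Sum>e\<le>\<beta> - c. shuffle_gf (\<alpha> - c) e)))"
    unfolding covering_gf_def by (subst shuffle_gf_rec) (rule refl)
  also have "\<dots> = (\<Sum>c\<le>min \<alpha> \<beta>. ?w c)
      + fps_X * (\<Sum>c\<le>min \<alpha> \<beta>. \<Sum>e\<le>\<alpha> - c. ?w c * shuffle_gf e (\<beta> - c))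
      + fps_const fps_X * (\<Sum>c\<le>min \<alpha> \<beta>. \<Sum>e\<le>\<beta> - c. ?w c * shuffle_gf (\<alpha> - c) e)"
    unfolding sum_distrib_left sum.distrib[symmetric] distrib_left mult_1_right
    by (simp only: mult.left_commute)
  also have "(\<Sum>c\<le>min \<alpha> \<beta>. \<Sum>e\<le>\<alpha> - c. ?w c * shuffle_gf e (\<beta> - c)) = (\<Sum>c\<le>\<alpha>. covering_gf t c \<beta>)"
    unfolding sum_diff_swap covering_gf_def ..
  also have "(\<Sum>c\<le>min \<alpha> \<beta>. \<Sum>e\<le>\<beta> - c. ?w c * shuffle_gf (\<alpha> - c) e) = (\<Sum>c\<le>\<beta>. covering_gf t \<alpha> c)"
    unfolding min.commute[of \<alpha> \<beta>] sum_diff_swap covering_gf_def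
    by (simp only: min.commute)
  finally show ?thesis .
qed

lemma covering_gf_diagonal: "covering_gf t c c = (overlap_gf 0 ^ Suc t) $ c"
  unfolding power_Suc2 fps_mult_nth covering_gf_def by (simp add: overlap_gf_0_nth atMost_atLeast0)

text \<open>
Both sides satisfy the same recursion. Where the index \<open>p\<close> or \<open>q\<close> is zero, the matching term of
\<open>covering_pairs\<close> vanishes because a subsequence would be longer than the word; for \<open>t = 0\<close> the term with a
common last letter vanishes because two subsequences would be too short to cover the word.
\<close>
lemma covering_pairs_eq_gf:
  "covering_pairs (t + p + q) (t + p) (t + q) \<alpha> \<beta> = covering_gf t \<alpha> \<beta> $ p $ q"
proof (induction "t + p + q" arbitrary: t p q \<alpha> \<beta>)
  case 0
  have "covering_gf 0 \<alpha> \<beta> $ 0 $ 0 = (\<Sum>c\<le>min \<alpha> \<beta>. if c = 0 then 1 else 0)"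
    unfolding covering_gf_def by (subst fps_sum_nth, subst fps_sum_nth, rule sum.cong) (auto simp: shuffle_gf_def)
  then show ?case using 0 by simp
next
  case (Suc m)
  have "(if t + p = 0 then 0 else \<Sum>c\<le>\<alpha>. covering_pairs m (t + p - 1) (t + q) c \<beta>)
      = (if p = 0 then 0 else \<Sum>c\<le>\<alpha>. covering_gf t c \<beta> $ (p - 1) $ q)"
  proof (cases p)
    case 0
    then show ?thesis using Suc.hyps(2) by (simp add: covering_pairs_eq_0)
  next
    case (Suc p')
    then have "m = t + p' + q" using Suc.hyps(2) by simp
    then show ?thesis using Suc.hyps(1)[of t p' q] Suc by simp
  qed
  moreover have "(if t + q = 0 then 0 else \<Sum>c\<le>\<beta>. covering_pairs m (t + p) (t + q - 1) \<alpha> c)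
      = (if q = 0 then 0 else \<Sum>c\<le>\<beta>. covering_gf t \<alpha> c $ p $ (q - 1))"
  proof (cases q)
    case 0
    then show ?thesis using Suc.hyps(2) by (simp add: covering_pairs_eq_0)
  next
    case (Suc q')
    then have "m = t + p + q'" using Suc.hyps(2) by simp
    then show ?thesis using Suc.hyps(1)[of t p q'] Suc by simp
  qed
  moreover have "(if t + p = 0 \<or> t + q = 0 then 0 else
        \<Sum>c\<le>min \<alpha> \<beta>. covering_pairs m (t + p - 1) (t + q - 1) c c)
      = (\<Sum>c\<le>min \<alpha> \<beta>. (overlap_gf 0 ^ t) $ c $ p $ q)"
  proof (cases t)
    case 0
    then have "(overlap_gf 0 ^ t) $ c $ p $ q = 0" for c using Suc.hyps(2) by simp
    moreover have "covering_pairs m (t + p - 1) (t + q - 1) c c = 0" if "p \<noteq> 0" "q \<noteq> 0" for c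
      using that Suc.hyps(2) 0 by (intro covering_pairs_eq_0) auto
    ultimately show ?thesis using 0 by simp
  next
    case (Suc t')
    then have "m = t' + p + q" using Suc.hyps(2) by simp
    then show ?thesis using Suc.hyps(1)[of t' p q] Suc by (simp add: covering_gf_diagonal del: power_Suc)
  qed
  ultimately have "covering_pairs (Suc m) (t + p) (t + q) \<alpha> \<beta> = covering_gf t \<alpha> \<beta> $ p $ q"
    by (subst covering_gf_rec) (simp add: fps_sum_nth)
  then show ?case using Suc.hyps(2) by simp
qed

lemma covering_pairs_diagonal:
  "covering_pairs (t + p + q) (t + p) (t + q) d d = overlap_coeff t p q d"
  unfolding covering_pairs_eq_gf covering_gf_diagonal overlap_gf_power overlap_gf_nth ..

lemma covering_pairs_no_overlap:
  "covering_pairs (p + q) p q \<alpha> \<beta>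
    = real (((p + q) choose p) * ((p + \<alpha>) choose p) * ((q + \<beta>) choose q))"
proof -
  have "covering_gf 0 \<alpha> \<beta> = (\<Sum>c\<in>{0}. (overlap_gf 0 ^ 0) $ c * shuffle_gf (\<alpha> - c) (\<beta> - c))"
    unfolding covering_gf_def by (rule sum.mono_neutral_right) auto
  then show ?thesis
    using covering_pairs_eq_gf[of 0 p q \<alpha> \<beta>] by (simp add: shuffle_gf_def)
qed

lemma covering_pairs_single_overlap:
  "covering_pairs (Suc (p + q)) (Suc p) (Suc q) d d
    = (\<Sum>c\<le>d. \<Sum>i\<le>p. \<Sum>j\<le>q. shuffle_gf c c $ i $ j * shuffle_gf (d - c) (d - c) $ (p - i) $ (q - j))"
proof -
  have "covering_pairs (Suc (p + q)) (Suc p) (Suc q) d d = (overlap_gf 0 * overlap_gf 0) $ d $ p $ q"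
    using covering_pairs_eq_gf[of 1 p q d d] by (simp add: covering_gf_diagonal)
  then show ?thesis
    by (simp add: fps_mult_nth fps_sum_nth overlap_gf_0_nth atMost_atLeast0)
qed

section \<open>Expectations over uniform words\<close>

context prob_space
begin

text \<open>
Each letter takes countably many values, so the letters can be fixed one at a time.
\<close>
lemma borel_measurable_of_finitely_many:
  fixes X :: "nat \<Rightarrow> 'a \<Rightarrow> nat" and F :: "(nat \<Rightarrow> nat) \<Rightarrow> real"
  assumes X: "\<And>i. i \<ge> 1 \<Longrightarrow> X i \<in> measurable M (count_space UNIV)"
    and F: "\<And>x y. (\<And>i. i \<in> {1..n} \<Longrightarrow> x i = y i) \<Longrightarrow> F x = F y"
  shows "(\<lambda>\<omega>. F (\<lambda>i. X i \<omega>)) \<in> borel_measurable M"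
  using F
proof (induction n arbitrary: F)
  case 0
  have "(\<lambda>\<omega>. F (\<lambda>i. X i \<omega>)) = (\<lambda>\<omega>. F (\<lambda>i. 0))"
    by (rule ext, rule 0) auto
  then show ?case by simp
next
  case (Suc n)
  have "(\<lambda>\<omega>. F ((\<lambda>i. X i \<omega>)(Suc n := c))) \<in> borel_measurable M" for c
    by (rule Suc.IH[of "\<lambda>x. F (x(Suc n := c))"], rule Suc.prems) auto
  then have "(\<lambda>\<omega>. F ((\<lambda>i. X i \<omega>)(Suc n := X (Suc n) \<omega>))) \<in> borel_measurable M"
    by (rule measurable_compose_countable) (rule X, simp)
  moreover have "(\<lambda>i. X i \<omega>)(Suc n := X (Suc n) \<omega>) = (\<lambda>i. X i \<omega>)" for \<omega>
    by auto
  ultimately show ?case by (simp only:)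
qed

text \<open>
Almost surely the first \<open>n\<close> letters spell exactly one of the \<open>a ^ n\<close> words over \<open>{1..a}\<close>, and by independence each of
them has probability \<open>1 / a ^ n\<close>.
\<close>
lemma uniform_letters:
  fixes X :: "nat \<Rightarrow> 'a \<Rightarrow> nat" and F :: "(nat \<Rightarrow> nat) \<Rightarrow> real"
  assumes indep: "indep_vars (\<lambda>_. count_space UNIV) X {1..}"
    and unif: "\<And>i. i \<ge> 1 \<Longrightarrow> distr M (count_space UNIV) (X i) = measure_pmf (pmf_of_set {1..a})"
    and a: "a \<ge> 1"
    and F: "\<And>x y. (\<And>i. i \<in> {1..n} \<Longrightarrow> x i = y i) \<Longrightarrow> F x = F y"
  shows integrable_words: "integrable M (\<lambda>\<omega>. F (\<lambda>i. X i \<omega>))"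
    and expectation_words: "expectation (\<lambda>\<omega>. F (\<lambda>i. X i \<omega>))
      = (\<Sum>w\<in>PiE {1..n} (\<lambda>_. {1..a}). F w) / real a ^ n"
proof -
  have X: "X i \<in> measurable M (count_space UNIV)" if "i \<ge> 1" for i
    using indep that by (auto simp: indep_vars_def)
  have letter_prob: "prob (X i -` {c} \<inter> space M) = 1 / real a" if "i \<ge> 1" "c \<in> {1..a}" for i c
  proof -
    have "prob (X i -` {c} \<inter> space M) = measure (distr M (count_space UNIV) (X i)) {c}"
      using X[OF that(1)] by (simp add: measure_distr)
    also have "\<dots> = pmf (pmf_of_set {1..a}) c"
      unfolding unif[OF that(1)] by (simp add: pmf.rep_eq)
    also have "\<dots> = 1 / real a"
      using a that by (subst pmf_of_set) auto
    finally show ?thesis .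
  qed
  have AE_letter: "AE \<omega> in M. X i \<omega> \<in> {1..a}" if "i \<ge> 1" for i
  proof -
    have "AE c in distr M (count_space UNIV) (X i). c \<in> {1..a}"
      unfolding unif[OF that] AE_measure_pmf_iff using a by simp
    then show ?thesis by (rule AE_distrD[OF X[OF that]])
  qed
  have letters: "AE \<omega> in M. \<forall>i\<in>{1..n}. X i \<omega> \<in> {1..a}"
    using AE_letter by (intro AE_finite_allI) auto
  let ?W = "PiE {1..n} (\<lambda>_. {1..a})"
  define A where "A w = {\<omega> \<in> space M. \<forall>i\<in>{1..n}. X i \<omega> = w i}" for w
  have A_events: "A w \<in> events" for w
    unfolding A_def
  proof (rule sets.sets_Collect_finite_All)
    fix i assume "i \<in> {1..n}"
    then have "X i -` {w i} \<inter> space M \<in> events"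
      by (intro measurable_sets[OF X]) auto
    moreover have "X i -` {w i} \<inter> space M = {\<omega> \<in> space M. X i \<omega> = w i}" by auto
    ultimately show "{\<omega> \<in> space M. X i \<omega> = w i} \<in> events" by simp
  qed simp
  have A_prob: "prob (A w) = 1 / real a ^ n" if "w \<in> ?W" for w
  proof (cases "n = 0")
    case True
    then show ?thesis by (simp add: A_def prob_space)
  next
    case False
    have "A w = (\<Inter>i\<in>{1..n}. X i -` {w i} \<inter> space M)"
      using False by (auto simp: A_def)
    also have "prob \<dots> = (\<Prod>i\<in>{1..n}. prob (X i -` {w i} \<inter> space M))"
      using False by (intro indep_varsD[OF indep]) auto
    also have "\<dots> = (\<Prod>i\<in>{1..n}. 1 / real a)"
      using that by (intro prod.cong refl letter_prob) auto
    finally show ?thesis by (simp add: power_one_over)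
  qed
  define g where "g \<omega> = (\<Sum>w\<in>?W. F w * indicator (A w) \<omega>)" for \<omega>
  have fin: "finite ?W" by (intro finite_PiE) auto
  have g_int: "integrable M g"
    unfolding g_def using A_events
    by (intro Bochner_Integration.integrable_sum integrable_mult_right integrable_real_indicator)
       (auto simp: emeasure_eq_measure)
  have eq: "AE \<omega> in M. F (\<lambda>i. X i \<omega>) = g \<omega>"
    using letters AE_space
  proof eventually_elim
    case (elim \<omega>)
    define w0 where "w0 = restrict (\<lambda>i. X i \<omega>) {1..n}"
    have w0: "w0 \<in> ?W" using elim by (auto simp: w0_def)
    have "indicator (A w) \<omega> = (if w = w0 then 1 else 0 :: real)" if "w \<in> ?W" for w
    proof -
      have "\<omega> \<in> A w \<longleftrightarrow> w = w0"
      proof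
        assume "\<omega> \<in> A w"
        then show "w = w0"
          using that w0 by (intro PiE_ext[OF that w0]) (auto simp: A_def w0_def)
      qed (use elim in \<open>auto simp: A_def w0_def\<close>)
      then show ?thesis by (auto simp: indicator_def)
    qed
    then have "g \<omega> = (\<Sum>w\<in>?W. if w = w0 then F w else 0)"
      unfolding g_def by (intro sum.cong) auto
    also have "\<dots> = F w0" using fin w0 by simp
    also have "\<dots> = F (\<lambda>i. X i \<omega>)" by (rule F) (auto simp: w0_def)
    finally show ?case ..
  qed
  have meas: "(\<lambda>\<omega>. F (\<lambda>i. X i \<omega>)) \<in> borel_measurable M"
    by (rule borel_measurable_of_finitely_many[OF X F])
  show "integrable M (\<lambda>\<omega>. F (\<lambda>i. X i \<omega>))"
    using integrable_cong_AE[OF meas _ eq] g_int by auto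
  have "expectation (\<lambda>\<omega>. F (\<lambda>i. X i \<omega>)) = expectation g"
    using g_int by (intro integral_cong_AE meas eq) auto
  also have "\<dots> = (\<Sum>w\<in>?W. F w * prob (A w))"
    unfolding g_def using A_events
    by (subst Bochner_Integration.integral_sum)
       (auto simp: emeasure_eq_measure intro!: integrable_mult_right integrable_real_indicator)
  also have "\<dots> = (\<Sum>w\<in>?W. F w / real a ^ n)"
    by (intro sum.cong refl) (simp add: A_prob)
  finally show "expectation (\<lambda>\<omega>. F (\<lambda>i. X i \<omega>))
      = (\<Sum>w\<in>?W. F w) / real a ^ n"
    by (simp add: sum_divide_distrib)
qed

end

section \<open>First and second moment\<close>

lemma weakly_incr_subseqs_cong:
  assumes "\<And>i. i \<in> {1..n} \<Longrightarrow> x i = y i"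
  shows "weakly_incr_subseqs x n k = weakly_incr_subseqs y n k"
  unfolding weakly_incr_subseqs_def
proof (rule sum.cong[OF refl])
  fix js assume "js \<in> {js. length js = k \<and> sorted_wrt (<) js \<and> set js \<subseteq> {1..n}}"
  then have "map x js = map y js" using assms by auto
  then show "(of_bool (sorted (map x js)) :: nat) = of_bool (sorted (map y js))"
    by (simp only:)
qed

lemma binomial_sum_rescale:
  fixes c :: "nat \<Rightarrow> real" and A :: real
  assumes "A \<noteq> 0" "\<And>m. m > N \<Longrightarrow> c m = 0"
  shows "(\<Sum>m\<le>n. real (n choose m) * A ^ (n - m) * c m) / A ^ n
    = (\<Sum>m\<le>N. c m / A ^ m * real (n choose m))"
proof -
  have "(\<Sum>m\<le>n. real (n choose m) * A ^ (n - m) * c m) / A ^ n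
      = (\<Sum>m\<le>n. c m / A ^ m * real (n choose m))"
    unfolding sum_divide_distrib
  proof (rule sum.cong[OF refl])
    fix m assume "m \<in> {..n}"
    then have "A ^ n = A ^ m * A ^ (n - m)" by (simp flip: power_add)
    then show "real (n choose m) * A ^ (n - m) * c m / A ^ n = c m / A ^ m * real (n choose m)"
      using assms(1) by simp
  qed
  also have "\<dots> = (\<Sum>m\<le>n + N. c m / A ^ m * real (n choose m))"
    by (rule sum.mono_neutral_left) (auto simp: binomial_eq_0)
  also have "\<dots> = (\<Sum>m\<le>N. c m / A ^ m * real (n choose m))"
    by (rule sum.mono_neutral_right) (auto simp: assms(2))
  finally show ?thesis .
qed

context prob_space
begin

text \<open>
Summed over all words, the square is \<open>word_sum\<close> with both lengths \<open>k\<close>, and the count itself is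
\<open>word_sum\<close> with second length \<open>0\<close>, because there is one empty subsequence.
\<close>
lemma moments_eq:
  fixes X :: "nat \<Rightarrow> 'a \<Rightarrow> nat"
  assumes indep: "indep_vars (\<lambda>_. count_space UNIV) X {1..}"
    and unif: "\<And>i. i \<ge> 1 \<Longrightarrow> distr M (count_space UNIV) (X i) = measure_pmf (pmf_of_set {1..a})"
    and a: "a \<ge> 1"
  shows integrable_Y: "integrable M (Y X n k)"
    and integrable_Y2: "integrable M (\<lambda>\<omega>. (Y X n k \<omega>)\<^sup>2)"
    and expectation_Y: "expectation (Y X n k)
      = real ((k + (a - 1)) choose k) / real a ^ k * real (n choose k)"
    and expectation_Y2: "expectation (\<lambda>\<omega>. (Y X n k \<omega>)\<^sup>2)
      = (\<Sum>m\<le>2 * k. covering_pairs m k k (a - 1) (a - 1) / real a ^ m * real (n choose m))"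
proof -
  let ?W = "PiE {1..n} (\<lambda>_. {1..a})"
  let ?F = "\<lambda>x. real (weakly_incr_subseqs x n k)"
  have dep: "?F x = ?F y" if "\<And>i. i \<in> {1..n} \<Longrightarrow> x i = y i" for x y
    using weakly_incr_subseqs_cong[of n x y k] that by simp
  have dep2: "(?F x)\<^sup>2 = (?F y)\<^sup>2" if "\<And>i. i \<in> {1..n} \<Longrightarrow> x i = y i" for x y
    using dep[OF that] by simp
  have Y_eq: "Y X n k = (\<lambda>\<omega>. ?F (\<lambda>i. X i \<omega>))"
    by (rule ext) (simp add: Y_def)
  have words: "?F w = real (bounded_incr w n k (Suc (a - 1)))" if "w \<in> ?W" for w
  proof -
    have "w i \<le> Suc (a - 1)" if "i \<in> {1..n}" for i
      using PiE_mem[OF \<open>w \<in> ?W\<close> that] by simp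
    from weakly_incr_subseqs_eq_bounded_incr[OF this] show ?thesis by simp
  qed
  have a0: "real a \<noteq> 0" "a - 1 < a" using a by simp_all
  show "integrable M (Y X n k)"
    unfolding Y_eq by (rule integrable_words[where F = ?F, OF indep unif a dep])
  show "integrable M (\<lambda>\<omega>. (Y X n k \<omega>)\<^sup>2)"
    unfolding Y_eq by (rule integrable_words[where F = "\<lambda>x. (?F x)\<^sup>2", OF indep unif a dep2])
  have "expectation (Y X n k) = (\<Sum>w\<in>?W. ?F w) / real a ^ n"
    unfolding Y_eq by (rule expectation_words[where F = ?F, OF indep unif a dep])
  also have "(\<Sum>w\<in>?W. ?F w) = word_sum a n k 0 (a - 1) (a - 1)"
    unfolding word_sum_def bounded_incr_0 by (rule sum.cong[OF refl]) (simp only: words of_nat_1 mult_1_right)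
  also have "\<dots> / real a ^ n
      = (\<Sum>m\<le>k. covering_pairs m k 0 (a - 1) (a - 1) / real a ^ m * real (n choose m))"
    unfolding word_sum_eq[OF a0(2) a0(2)] using a0 by (intro binomial_sum_rescale) (auto intro: covering_pairs_eq_0)
  also have "\<dots> = (\<Sum>m\<in>{k}. covering_pairs m k 0 (a - 1) (a - 1) / real a ^ m * real (n choose m))"
    by (rule sum.mono_neutral_right) (auto intro: covering_pairs_eq_0)
  also have "\<dots> = real ((k + (a - 1)) choose k) / real a ^ k * real (n choose k)"
    using covering_pairs_no_overlap[of k 0 "a - 1" "a - 1"] by simp
  finally show "expectation (Y X n k) = real ((k + (a - 1)) choose k) / real a ^ k * real (n choose k)" .
  have "expectation (\<lambda>\<omega>. (Y X n k \<omega>)\<^sup>2) = (\<Sum>w\<in>?W. (?F w)\<^sup>2) / real a ^ n"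
    unfolding Y_eq by (rule expectation_words[where F = "\<lambda>x. (?F x)\<^sup>2", OF indep unif a dep2])
  also have "(\<Sum>w\<in>?W. (?F w)\<^sup>2) = word_sum a n k k (a - 1) (a - 1)"
    unfolding word_sum_def by (rule sum.cong[OF refl]) (simp only: words power2_eq_square)
  also have "\<dots> / real a ^ n
      = (\<Sum>m\<le>2 * k. covering_pairs m k k (a - 1) (a - 1) / real a ^ m * real (n choose m))"
    unfolding word_sum_eq[OF a0(2) a0(2)] using a0 by (intro binomial_sum_rescale) (auto intro: covering_pairs_eq_0)
  finally show "expectation (\<lambda>\<omega>. (Y X n k \<omega>)\<^sup>2)
      = (\<Sum>m\<le>2 * k. covering_pairs m k k (a - 1) (a - 1) / real a ^ m * real (n choose m))" .
qed

end

text \<open>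
Positions covered and positions shared determine each other: \<open>m = 2 * k - t\<close>.
\<close>
lemma sum_covering_pairs_by_overlap:
  assumes "a \<ge> 1"
  shows "(\<Sum>m\<le>2 * k. covering_pairs m k k (a - 1) (a - 1) / real a ^ m * real (n choose m))
    = (\<Sum>t = 0..k. overlap_coeff t (k - t) (k - t) (a - 1) / real a ^ (2 * k - t) * real (n choose (2 * k - t)))"
proof -
  let ?f = "\<lambda>m. covering_pairs m k k (a - 1) (a - 1) / real a ^ m * real (n choose m)"
  have "(\<Sum>m\<le>2 * k. ?f m) = (\<Sum>m\<in>{k..2 * k}. ?f m)"
    by (rule sum.mono_neutral_right) (auto intro: covering_pairs_eq_0)
  also have "\<dots> = (\<Sum>t = 0..k. ?f (2 * k - t))"
    by (rule sum.reindex_bij_witness[where i = "\<lambda>t. 2 * k - t" and j = "\<lambda>m. 2 * k - m"]) auto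
  also have "\<dots> = (\<Sum>t = 0..k. overlap_coeff t (k - t) (k - t) (a - 1) / real a ^ (2 * k - t) * real (n choose (2 * k - t)))"
  proof (rule sum.cong[OF refl])
    fix t assume "t \<in> {0..k}"
    then have "t + (k - t) + (k - t) = 2 * k - t" "t + (k - t) = k" by auto
    then show "?f (2 * k - t)
        = overlap_coeff t (k - t) (k - t) (a - 1) / real a ^ (2 * k - t) * real (n choose (2 * k - t))"
      using covering_pairs_diagonal[of t "k - t" "k - t" "a - 1"] by (simp only:)
  qed
  finally show ?thesis .
qed

text \<open>
The two last binomial coefficients form a multinomial coefficient up to a factor \<open>(2 * q) choose q\<close>, which is
supplied by \<open>4 ^ q * ((q - 1 / 2) gchoose q)\<close>. Here \<open>q = k - t - s\<close> and \<open>e = a - 1 - s\<close>.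
\<close>
lemma overlap_coeff_term_eq:
  fixes t p q s e :: nat
  shows "4 ^ (s + q) * ((real q - 1 / 2) gchoose q) * ((real s + (real t + 1) / 2 - 1) gchoose s)
      * (real (t + 2 * s + (2 * q + e)) gchoose (t + 2 * s)) * (real (2 * q + e) gchoose e)
    = root_coeff t s * (fact (t + 2 * s + (2 * q + e)) / (fact (t + 2 * s) * fact q * fact q * fact e))"
proof -
  have "4 ^ (s + q) * ((real q - 1 / 2) gchoose q) * ((real s + (real t + 1) / 2 - 1) gchoose s)
      = root_coeff t s * root_coeff 0 q"
    by (simp add: root_coeff_def power_add)
  moreover have "real (t + 2 * s + (2 * q + e)) gchoose (t + 2 * s)
      = fact (t + 2 * s + (2 * q + e)) / (fact (t + 2 * s) * fact (2 * q + e))"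
    by (subst binomial_gbinomial[symmetric], subst binomial_fact) simp_all
  moreover have "real (2 * q + e) gchoose e = fact (2 * q + e) / (fact e * fact (2 * q))"
    by (subst binomial_gbinomial[symmetric], subst binomial_fact) simp_all
  ultimately show ?thesis
    by (simp add: root_coeff_0 power2_eq_square)
qed

lemma overlap_coeff_eq_gchoose:
  fixes t k a :: nat
  assumes "t \<le> k" "a \<ge> 1"
  shows "overlap_coeff t (k - t) (k - t) (a - 1) = (\<Sum>s = 0..min (a - 1) (k - t). 4 ^ (k - t)
     * ((real k - real t - real s - 1 / 2) gchoose (k - t - s))
     * ((real s + (real t + 1) / 2 - 1) gchoose s)
     * ((2 * real k - real t - real s + real a - 1) gchoose (t + 2 * s))
     * ((2 * real k - 2 * real t - 3 * real s + real a - 1) gchoose (a - 1 - s)))"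
  unfolding overlap_coeff_def atMost_atLeast0 min.idem
proof (rule sum.cong[OF refl])
  fix s assume "s \<in> {0..min (a - 1) (k - t)}"
  then obtain q e where k: "k = t + (s + q)" and a: "a = Suc (s + e)"
    using assms by (metis atLeastAtMost_iff le_add_diff_inverse min.boundedE One_nat_def Suc_diff_1 Suc_le_eq)
  have "k - t - s = q" "a - 1 - s = e" "k - t = s + q"
    "k - t + (k - t) + (a - 1) + t - s = t + 2 * s + (2 * q + e)"
    "real k - real t - real s - 1 / 2 = real q - 1 / 2"
    "2 * real k - real t - real s + real a - 1 = real (t + 2 * s + (2 * q + e))"
    "2 * real k - 2 * real t - 3 * real s + real a - 1 = real (2 * q + e)"
    by (simp_all add: k a)
  then show "root_coeff t s * (fact (k - t + (k - t) + (a - 1) + t - s)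
        / (fact (t + 2 * s) * fact (k - t - s) * fact (k - t - s) * fact (a - 1 - s)))
     = 4 ^ (k - t)
     * ((real k - real t - real s - 1 / 2) gchoose (k - t - s))
     * ((real s + (real t + 1) / 2 - 1) gchoose s)
     * ((2 * real k - real t - real s + real a - 1) gchoose (t + 2 * s))
     * ((2 * real k - 2 * real t - 3 * real s + real a - 1) gchoose (a - 1 - s))"
    by (simp only: overlap_coeff_term_eq)
qed

section \<open>Asymptotics of binomial sums\<close>

text \<open>
The binomial coefficient relative to its leading term; for positive \<open>n\<close> it is the product of \<open>1 - i / n\<close>
over \<open>i < m\<close>.
\<close>
definition choose_ratio :: "nat \<Rightarrow> nat \<Rightarrow> real" where
  "choose_ratio m n = real (n choose m) * fact m / real n ^ m"

lemma choose_ratio_Suc: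
  assumes "n > 0"
  shows "choose_ratio (Suc m) n = choose_ratio m n * (1 - real m / real n)"
proof -
  have "(real n - real m) * real (n choose m) = real (Suc m) * real (n choose Suc m)"
    using gbinomial_mult_1[of "real n" m] by (simp add: binomial_gbinomial algebra_simps)
  moreover have "choose_ratio (Suc m) n
      = (real (Suc m) * real (n choose Suc m)) * fact m / (real n * real n ^ m)"
    by (simp add: choose_ratio_def algebra_simps)
  ultimately have "choose_ratio (Suc m) n
      = ((real n - real m) * real (n choose m)) * fact m / (real n * real n ^ m)"
    by (simp only:)
  then show ?thesis
    using assms by (simp add: choose_ratio_def field_simps)
qed

lemma choose_ratio_tendsto: "choose_ratio m \<longlonglongrightarrow> 1"
proof (induction m)
  case 0
  have "choose_ratio 0 = (\<lambda>n. 1)" by (rule ext) (simp add: choose_ratio_def)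
  then show ?case by simp
next
  case (Suc m)
  have "(\<lambda>n. choose_ratio m n * (1 - real m / real n)) \<longlonglongrightarrow> 1 * (1 - 0)"
    by (intro tendsto_intros Suc lim_const_over_n)
  moreover have "eventually (\<lambda>n. choose_ratio m n * (1 - real m / real n) = choose_ratio (Suc m) n) sequentially"
    using eventually_gt_at_top[of 0] by eventually_elim (simp add: choose_ratio_Suc)
  ultimately show ?case by (simp add: Lim_transform_eventually)
qed

lemma choose_ratio_second_order:
  "(\<lambda>n. real n * (choose_ratio m n - 1)) \<longlonglongrightarrow> - (real m * (real m - 1) / 2)"
proof (induction m)
  case 0
  then show ?case by (simp add: choose_ratio_def)
next
  case (Suc m)
  have "(\<lambda>n. real n * (choose_ratio m n - 1) - real m * choose_ratio m n)
      \<longlonglongrightarrow> - (real m * (real m - 1) / 2) - real m * 1"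
    by (intro tendsto_intros Suc choose_ratio_tendsto)
  moreover have "eventually (\<lambda>n. real n * (choose_ratio m n - 1) - real m * choose_ratio m n
      = real n * (choose_ratio (Suc m) n - 1)) sequentially"
    using eventually_gt_at_top[of 0]
    by eventually_elim (simp add: choose_ratio_Suc field_simps)
  moreover have "- (real m * (real m - 1) / 2) - real m * 1 = - (real (Suc m) * (real (Suc m) - 1) / 2)"
    by (simp add: field_simps)
  ultimately show ?case by (simp only: Lim_transform_eventually)
qed

lemma choose_eq_choose_ratio:
  "n > 0 \<Longrightarrow> real (n choose m) = choose_ratio m n * real n ^ m / fact m"
  by (simp add: choose_ratio_def)

lemma binomial_sum_leading_term:
  fixes b :: "nat \<Rightarrow> real"
  shows "(\<lambda>n. (\<Sum>m\<le>N. b m * real (n choose m)) / real n ^ N) \<longlonglongrightarrow> b N / fact N"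
proof -
  have "(\<lambda>n. b m * real (n choose m) / real n ^ N)
      \<longlonglongrightarrow> (if m = N then b N / fact N else 0)" if "m \<le> N" for m
  proof -
    have "(\<lambda>n. b m * choose_ratio m n / fact m * (1 / real n) ^ (N - m))
        \<longlonglongrightarrow> b m * 1 / fact m * 0 ^ (N - m)"
      by (intro tendsto_intros choose_ratio_tendsto lim_1_over_n) simp
    moreover have "b m * 1 / fact m * 0 ^ (N - m) = (if m = N then b N / fact N else 0)"
      using that by simp
    moreover have "eventually (\<lambda>n. b m * choose_ratio m n / fact m * (1 / real n) ^ (N - m)
        = b m * real (n choose m) / real n ^ N) sequentially"
      using eventually_gt_at_top[of 0]
    proof eventually_elim
      case (elim n)
      have "real n ^ N = real n ^ m * real n ^ (N - m)"
        using that by (simp flip: power_add)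
      then show ?case using elim by (simp add: choose_eq_choose_ratio power_one_over)
    qed
    ultimately show ?thesis by (simp only: Lim_transform_eventually)
  qed
  then have "(\<lambda>n. \<Sum>m\<le>N. b m * real (n choose m) / real n ^ N)
      \<longlonglongrightarrow> (\<Sum>m\<le>N. if m = N then b N / fact N else 0)"
    by (intro tendsto_sum) auto
  then show ?thesis by (simp add: sum_divide_distrib)
qed

text \<open>
Under the hypothesis on \<open>b (2 * k)\<close> the terms of order \<open>n ^ (2 * k)\<close> cancel. With \<open>R\<close> and \<open>r\<close> the ratios of
\<open>n choose (2 * k)\<close> and \<open>n choose k\<close> to their leading terms, what is left of them is a multiple of
\<open>n * (R - r\<^sup>2) = n * (R - 1) - n * (r - 1) * (r + 1)\<close>, which tends to
\<open>- k * (2 * k - 1) + k * (k - 1) = - k\<^sup>2\<close>.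
\<close>
lemma variance_leading_term:
  fixes b :: "nat \<Rightarrow> real" and e :: real
  assumes k: "k \<ge> 1" and top: "b (2 * k) / fact (2 * k) = (e / fact k)\<^sup>2"
  shows "(\<lambda>n. ((\<Sum>m\<le>2 * k. b m * real (n choose m)) - (e * real (n choose k))\<^sup>2) / real n ^ (2 * k - 1))
    \<longlonglongrightarrow> b (2 * k - 1) / fact (2 * k - 1) - (e / fact (k - 1))\<^sup>2"
proof -
  let ?K = "2 * k - 1"
  have K: "2 * k = Suc ?K" using k by simp
  have low: "(\<lambda>n. (\<Sum>m\<le>?K. b m * real (n choose m)) / real n ^ ?K) \<longlonglongrightarrow> b ?K / fact ?K"
    by (rule binomial_sum_leading_term)
  have "(\<lambda>n. (e / fact k)\<^sup>2 * (real n * (choose_ratio (2 * k) n - 1)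
        - real n * (choose_ratio k n - 1) * (choose_ratio k n + 1)))
      \<longlonglongrightarrow> (e / fact k)\<^sup>2 * (- (real (2 * k) * (real (2 * k) - 1) / 2)
        - - (real k * (real k - 1) / 2) * (1 + 1))"
    by (intro tendsto_intros choose_ratio_second_order choose_ratio_tendsto)
  also have "(e / fact k)\<^sup>2 * (- (real (2 * k) * (real (2 * k) - 1) / 2)
        - - (real k * (real k - 1) / 2) * (1 + 1)) = - (real k * e / fact k)\<^sup>2"
    by (simp add: power2_eq_square field_simps)
  also have "real k * e / fact k = e / fact (k - 1)"
    using k by (simp add: fact_reduce[of k])
  finally have high: "(\<lambda>n. (e / fact k)\<^sup>2 * (real n * (choose_ratio (2 * k) n - 1)
        - real n * (choose_ratio k n - 1) * (choose_ratio k n + 1)))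
      \<longlonglongrightarrow> - (e / fact (k - 1))\<^sup>2" .
  have "eventually (\<lambda>n. (\<Sum>m\<le>?K. b m * real (n choose m)) / real n ^ ?K
      + (e / fact k)\<^sup>2 * (real n * (choose_ratio (2 * k) n - 1)
        - real n * (choose_ratio k n - 1) * (choose_ratio k n + 1))
      = ((\<Sum>m\<le>2 * k. b m * real (n choose m)) - (e * real (n choose k))\<^sup>2) / real n ^ ?K) sequentially"
    using eventually_gt_at_top[of 0]
  proof eventually_elim
    case (elim n)
    define r where "r = choose_ratio k n"
    define R where "R = choose_ratio (2 * k) n"
    have pw: "real n ^ (2 * k) = real n * real n ^ ?K" by (subst K) simp
    have "b (2 * k) * real (n choose (2 * k)) = (e / fact k)\<^sup>2 * R * real n * real n ^ ?K"
    proof -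
      have "b (2 * k) * real (n choose (2 * k)) = b (2 * k) / fact (2 * k) * R * real n ^ (2 * k)"
        unfolding choose_eq_choose_ratio[OF elim, of "2 * k"] R_def by simp
      then show ?thesis unfolding top pw by (simp only: mult_ac)
    qed
    moreover have "(e * real (n choose k))\<^sup>2 = (e / fact k)\<^sup>2 * r\<^sup>2 * real n * real n ^ ?K"
    proof -
      have "(real n ^ k)\<^sup>2 = real n ^ (2 * k)" by (simp add: mult.commute flip: power_mult)
      moreover have "(e * real (n choose k))\<^sup>2 = (e / fact k)\<^sup>2 * r\<^sup>2 * (real n ^ k)\<^sup>2"
        unfolding choose_eq_choose_ratio[OF elim, of k] r_def
        by (simp add: power_mult_distrib power_divide)
      ultimately show ?thesis unfolding pw by (simp only: mult_ac)
    qed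
    moreover have split: "(\<Sum>m\<le>2 * k. b m * real (n choose m))
        = (\<Sum>m\<le>?K. b m * real (n choose m)) + b (2 * k) * real (n choose (2 * k))"
      using sum.atMost_Suc[of "\<lambda>m. b m * real (n choose m)" ?K] by (simp only: K[symmetric])
    ultimately have "((\<Sum>m\<le>2 * k. b m * real (n choose m)) - (e * real (n choose k))\<^sup>2)
        = (\<Sum>m\<le>?K. b m * real (n choose m)) + (e / fact k)\<^sup>2 * (real n * (R - r\<^sup>2)) * real n ^ ?K"
      unfolding split by (simp add: algebra_simps)
    moreover have "real n * (R - r\<^sup>2) = real n * (R - 1) - real n * (r - 1) * (r + 1)"
      by (simp add: power2_eq_square algebra_simps)
    ultimately show ?case using elim
      by (simp add: r_def R_def add_divide_distrib)
  qed
  from Lim_transform_eventually[OF tendsto_add[OF low high] this] show ?thesis by simp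
qed

lemma asymp_equiv_power_of_tendsto:
  fixes f :: "nat \<Rightarrow> real"
  assumes "(\<lambda>n. f n / real n ^ N) \<longlonglongrightarrow> L" "L \<noteq> 0"
  shows "f \<sim>[sequentially] (\<lambda>n. L * real n ^ N)"
proof (rule asymp_equivI')
  have "(\<lambda>n. f n / real n ^ N / L) \<longlonglongrightarrow> L / L"
    using assms by (intro tendsto_intros)
  then show "(\<lambda>n. f n / (L * real n ^ N)) \<longlonglongrightarrow> 1"
    using assms by (simp add: mult.commute)
qed

section \<open>The variance constant\<close>

text \<open>
The Beta integral with natural exponents. The derivative of \<open>x ^ (i + 1) * (1 - x) ^ (j + 1)\<close>, which
vanishes at both endpoints, relates the integral for \<open>(i, j + 1)\<close> to the one for \<open>(i + 1, j)\<close>.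
\<close>
lemma has_integral_power_mult_power:
  "((\<lambda>x::real. x ^ i * (1 - x) ^ j) has_integral (fact i * fact j / fact (i + j + 1))) {0..1}"
proof (induction j arbitrary: i)
  case 0
  have "((\<lambda>x::real. x ^ i) has_integral (1 ^ Suc i / real (Suc i) - 0 ^ Suc i / real (Suc i))) {0..1}"
    by (rule fundamental_theorem_of_calculus)
       (auto intro!: derivative_eq_intros simp del: power_Suc of_nat_Suc
          simp flip: has_real_derivative_iff_has_vector_derivative)
  moreover have "1 ^ Suc i / real (Suc i) - 0 ^ Suc i / real (Suc i)
      = (fact i * fact 0 / fact (i + 0 + 1) :: real)"
  proof -
    have "fact (i + 0 + 1) = real (Suc i) * fact i" by simp
    then show ?thesis by (simp del: fact_Suc of_nat_Suc)
  qed
  ultimately show ?case by simp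
next
  case (Suc j)
  define F where "F x = x ^ Suc i * (1 - x) ^ Suc j / real (Suc i)" for x :: real
  define F' where "F' x = x ^ i * (1 - x) ^ Suc j - real (Suc j) / real (Suc i) * (x ^ Suc i * (1 - x) ^ j)"
    for x :: real
  have "(F' has_integral (F 1 - F 0)) {0..1}"
  proof (rule fundamental_theorem_of_calculus)
    fix x :: real
    have "(F has_real_derivative
        (real (Suc i) * x ^ i * (1 - x) ^ Suc j - x ^ Suc i * (real (Suc j) * (1 - x) ^ j)) / real (Suc i))
        (at x within {0..1})"
      unfolding F_def by (auto intro!: derivative_eq_intros simp del: power_Suc of_nat_Suc)
    also have "(real (Suc i) * x ^ i * (1 - x) ^ Suc j - x ^ Suc i * (real (Suc j) * (1 - x) ^ j)) / real (Suc i)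
        = F' x"
      unfolding F'_def by (simp add: diff_divide_distrib)
    finally show "(F has_vector_derivative F' x) (at x within {0..1})"
      by (simp add: has_real_derivative_iff_has_vector_derivative)
  qed simp
  then have "(F' has_integral 0) {0..1}" by (simp add: F_def)
  from has_integral_add[OF this has_integral_mult_right[OF Suc.IH[of "Suc i"], of "real (Suc j) / real (Suc i)"]]
  have "((\<lambda>x. x ^ i * (1 - x) ^ Suc j) has_integral
      (real (Suc j) / real (Suc i) * (fact (Suc i) * fact j / fact (Suc i + j + 1)))) {0..1}"
    unfolding F'_def by simp
  moreover have "real (Suc j) / real (Suc i) * (fact (Suc i) * fact j / fact (Suc i + j + 1))
      = fact i * fact (Suc j) / fact (i + Suc j + 1)"
  proof -
    have "fact (Suc i) = real (Suc i) * fact i" "fact (Suc j) = real (Suc j) * fact j"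
      "Suc i + j + 1 = i + Suc j + 1" by simp_all
    then show ?thesis by (simp del: fact_Suc of_nat_Suc)
  qed
  ultimately show ?case by (simp only:)
qed

text \<open>
This compares coefficients in the product of the powers \<open>- (i + 1)\<close> and \<open>- (j + 1)\<close> of \<open>1 - z\<close>.
\<close>
lemma sum_choose_mult_choose:
  "(\<Sum>c\<le>d. ((i + c) choose i) * ((j + (d - c)) choose j)) = (i + j + 1 + d) choose (i + j + 1)"
proof -
  have coeff: "(geom 1 ^ Suc n) $ c = real ((n + c) choose n)" for n c
    by (simp only: geom_power_nth power_one mult_1_right of_nat_eq_iff)
       (metis add.commute binomial_symmetric diff_add_inverse2 le_add1 le_add2 add_diff_cancel_left')
  have "real ((i + j + 1 + d) choose (i + j + 1)) = (geom 1 ^ Suc i * geom 1 ^ Suc j) $ d"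
    unfolding coeff[symmetric] power_add[symmetric] by simp
  also have "\<dots> = (\<Sum>c\<le>d. real ((i + c) choose i) * real ((j + (d - c)) choose j))"
    unfolding fps_mult_nth coeff atMost_atLeast0 ..
  also have "\<dots> = real (\<Sum>c\<le>d. ((i + c) choose i) * ((j + (d - c)) choose j))" by simp
  finally show ?thesis by (simp only: of_nat_eq_iff)
qed

text \<open>
The Beta integral turns the right-hand side into \<open>Suc d\<close> times the sum over \<open>c\<close> of the integrals of
\<open>(h c x)\<^sup>2\<close>, and the left-hand side is the square of the sum over \<open>c\<close> of the integrals of \<open>h c x\<close>. The difference is
\<open>Suc d\<close> times the sum of the integrals of \<open>(h c x - m)\<^sup>2\<close>, with \<open>m\<close> the mean of \<open>h\<close>. Already the summand for
\<open>c = 0\<close> is positive, since \<open>h 0\<close> takes the distinct values \<open>((p + d) choose p) / fact p\<close> at \<open>0\<close> and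
\<open>1 / fact p\<close> at \<open>1\<close>.
\<close>
lemma single_overlap_gt:
  fixes p d :: nat
  assumes "p \<ge> 1" "d \<ge> 1"
  shows "(real ((p + 1 + d) choose (p + 1)) / fact p)\<^sup>2
    < real (Suc d) / fact (2 * p + 1) * covering_pairs (Suc (p + p)) (Suc p) (Suc p) d d"
proof -
  define u where "u c i = real ((i + c) choose i) * real ((p - i + (d - c)) choose (p - i))" for c i
  define v where "v c i = u c i / (fact i * fact (p - i))" for c i
  define h where "h c x = (\<Sum>i\<le>p. v c i * (x ^ i * (1 - x) ^ (p - i)))" for c and x :: real
  define H where "H c = (\<Sum>i\<le>p. v c i * (fact i * fact (p - i) / fact (p + 1)))" for c
  \<comment> \<open>\<open>H c\<close> and \<open>Q c\<close> are the integrals of \<open>h c x\<close> and \<open>(h c x)\<^sup>2\<close> over the unit interval, \<open>m\<close> is the mean of \<open>h\<close>.\<close>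
  define Q where "Q c = (\<Sum>i\<le>p. \<Sum>j\<le>p. v c i * v c j
      * (fact (i + j) * fact (p - i + (p - j)) / fact (2 * p + 1)))" for c
  define S where "S = (\<Sum>c\<le>d. H c)"
  define m where "m = S / real (Suc d)"
  have h_int: "(h c has_integral H c) {0..1}" for c
    unfolding h_def H_def
  proof (intro has_integral_sum has_integral_mult_right)
    fix i assume "i \<in> {..p}"
    then show "((\<lambda>x::real. x ^ i * (1 - x) ^ (p - i)) has_integral
        (fact i * fact (p - i) / fact (p + 1))) {0..1}"
      using has_integral_power_mult_power[of i "p - i"] by simp
  qed simp
  have sq: "(h c x)\<^sup>2 = (\<Sum>i\<le>p. \<Sum>j\<le>p. v c i * v c j * (x ^ (i + j) * (1 - x) ^ (p - i + (p - j))))" for c x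
    unfolding h_def power2_eq_square sum_product by (simp only: power_add mult_ac)
  have h2_int: "((\<lambda>x. (h c x)\<^sup>2) has_integral Q c) {0..1}" for c
    unfolding sq Q_def
  proof (intro has_integral_sum has_integral_mult_right)
    fix i j assume "i \<in> {..p}" "j \<in> {..p}"
    then have "i + j + (p - i + (p - j)) + 1 = 2 * p + 1" by simp
    then show "((\<lambda>x::real. x ^ (i + j) * (1 - x) ^ (p - i + (p - j))) has_integral
        (fact (i + j) * fact (p - i + (p - j)) / fact (2 * p + 1))) {0..1}"
      using has_integral_power_mult_power[of "i + j" "p - i + (p - j)"] by (simp only:)
  qed simp_all
  have dev: "((\<lambda>x. (h c x - m)\<^sup>2) has_integral (Q c - 2 * m * H c + m\<^sup>2)) {0..1}" for c
  proof -
    have "((\<lambda>x. m\<^sup>2) has_integral m\<^sup>2) {0..1::real}"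
      using has_integral_const_real[of "m\<^sup>2" 0 1] by simp
    from has_integral_add[OF has_integral_diff[OF h2_int has_integral_mult_right[OF h_int, of "2 * m"]] this]
    show ?thesis by (rule has_integral_eq_rhs[OF has_integral_eq, rotated])
        (simp_all add: power2_diff mult_ac)
  qed
  have nonneg: "Q c - 2 * m * H c + m\<^sup>2 \<ge> 0" for c
    using dev by (rule has_integral_nonneg) simp
  \<comment> \<open>A continuous nonnegative function with integral zero vanishes, so \<open>h 0\<close> would be constant.\<close>
  have pos: "Q 0 - 2 * m * H 0 + m\<^sup>2 > 0"
  proof (rule ccontr)
    assume "\<not> ?thesis"
    then have "Q 0 - 2 * m * H 0 + m\<^sup>2 = 0" using nonneg[of 0] by simp
    then have "integral {0..1} (\<lambda>x. (h 0 x - m)\<^sup>2) = 0"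
      using integral_unique[OF dev[of 0]] by simp
    moreover have "continuous_on {0..1} (\<lambda>x. (h 0 x - m)\<^sup>2)"
      unfolding h_def by (intro continuous_intros)
    ultimately have const: "\<forall>x\<in>{0..1}. (h 0 x - m)\<^sup>2 = 0"
      by (subst (asm) integral_eq_0_iff) auto
    then have "h 0 0 = h 0 1" by simp
    moreover have "h 0 0 = v 0 0"
      unfolding h_def by (subst sum.remove[of _ 0]) (auto intro!: sum.neutral)
    moreover have "h 0 1 = v 0 p"
      unfolding h_def by (subst sum.remove[of _ p]) (auto intro!: sum.neutral)
    ultimately have one: "(p + d) choose p = 1" by (simp add: v_def u_def)
    obtain p' d' where pd: "p = Suc p'" "d = Suc d'"
      using assms by (metis One_nat_def Suc_le_D)
    have "(Suc p' + Suc d') choose Suc p'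
        = ((p' + Suc d') choose p') + ((p' + Suc d') choose Suc p')"
      by simp
    moreover have "(p' + Suc d') choose p' > 0" "(p' + Suc d') choose Suc p' > 0"
      by (simp_all only: zero_less_binomial_iff)
    ultimately show False using one unfolding pd by linarith
  qed
  have "0 < (\<Sum>c\<le>d. Q c - 2 * m * H c + m\<^sup>2)"
    using pos nonneg by (intro sum_pos2[of _ 0]) auto
  also have "\<dots> = (\<Sum>c\<le>d. Q c) - 2 * m * S + real (Suc d) * m\<^sup>2"
    by (simp add: sum.distrib sum_subtractf sum_distrib_left S_def algebra_simps)
  also have "\<dots> = (\<Sum>c\<le>d. Q c) - S\<^sup>2 / real (Suc d)"
    by (simp add: m_def power2_eq_square field_simps del: of_nat_Suc)
  finally have "S\<^sup>2 < real (Suc d) * (\<Sum>c\<le>d. Q c)"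
    by (simp add: field_simps del: of_nat_Suc)
  moreover have "S = real ((p + 1 + d) choose (p + 1)) / fact p"
  proof -
    have "S = (\<Sum>c\<le>d. \<Sum>i\<le>p. u c i / fact (p + 1))"
      unfolding S_def H_def v_def by simp
    also have "\<dots> = (\<Sum>i\<le>p. (\<Sum>c\<le>d. u c i) / fact (p + 1))"
      by (subst sum.swap) (simp only: sum_divide_distrib)
    also have "\<dots> = (\<Sum>i\<le>p. real ((p + 1 + d) choose (p + 1)) / fact (p + 1))"
    proof (intro sum.cong refl)
      fix i assume "i \<in> {..p}"
      then have "(\<Sum>c\<le>d. ((i + c) choose i) * ((p - i + (d - c)) choose (p - i)))
          = (p + 1 + d) choose (p + 1)"
        using sum_choose_mult_choose[of i "p - i" d] by simp
      then have "(\<Sum>c\<le>d. u c i) = real ((p + 1 + d) choose (p + 1))"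
        unfolding u_def by (metis (mono_tags, lifting) of_nat_mult of_nat_sum sum.cong)
      then show "(\<Sum>c\<le>d. u c i) / fact (p + 1) = real ((p + 1 + d) choose (p + 1)) / fact (p + 1)"
        by simp
    qed
    also have "\<dots> = real ((p + 1 + d) choose (p + 1)) / fact p"
    proof -
      have "fact (p + 1) = real (Suc p) * fact p" by simp
      then show ?thesis by (simp del: fact_Suc of_nat_Suc binomial_Suc_Suc)
    qed
    finally show ?thesis .
  qed
  moreover have "(\<Sum>c\<le>d. Q c) = covering_pairs (Suc (p + p)) (Suc p) (Suc p) d d / fact (2 * p + 1)"
    unfolding covering_pairs_single_overlap Q_def sum_divide_distrib
  proof (intro sum.cong refl)
    fix c i j assume "c \<in> {..d}" "i \<in> {..p}" "j \<in> {..p}"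
    then have "real ((p - i + (p - j)) choose (p - i)) = fact (p - i + (p - j)) / (fact (p - i) * fact (p - j))"
      "real ((i + j) choose i) = fact (i + j) / (fact i * fact j)"
      by (simp_all add: binomial_fact)
    then show "v c i * v c j * (fact (i + j) * fact (p - i + (p - j)) / fact (2 * p + 1))
      = shuffle_gf c c $ i $ j * shuffle_gf (d - c) (d - c) $ (p - i) $ (p - j) / fact (2 * p + 1)"
      unfolding v_def u_def shuffle_gf_def fps_nth_Abs_fps of_nat_mult
      by (simp only: times_divide_eq_left times_divide_eq_right divide_divide_eq_left mult_ac)
  qed
  ultimately show ?thesis by simp
qed

text \<open>
The sum in \<open>C\<close> is the number of covering pairs with exactly one common position: for \<open>t = 1\<close> the exponent of the root is
\<open>-1\<close> and its coefficients are powers of \<open>4\<close>.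
\<close>
lemma C_eq:
  assumes "a \<ge> 1" "k \<ge> 1"
  shows "C k a = covering_pairs (2 * k - 1) k k (a - 1) (a - 1) / real a ^ (2 * k - 1) / fact (2 * k - 1)
      - (real ((k + (a - 1)) choose k) / real a ^ k / fact (k - 1))\<^sup>2"
proof -
  have "1 + (k - 1) + (k - 1) = 2 * k - 1" "1 + (k - 1) = k" using assms by auto
  then have cov: "covering_pairs (2 * k - 1) k k (a - 1) (a - 1) = overlap_coeff 1 (k - 1) (k - 1) (a - 1)"
    using covering_pairs_diagonal[of 1 "k - 1" "k - 1" "a - 1"] by (simp only:)
  have seg: "overlap_coeff 1 (k - 1) (k - 1) (a - 1) = (\<Sum>s = 0..min (a - 1) (k - 1).
           4 ^ s * (fact (2 * k + a - s - 2) /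
             (fact (2 * s + 1) * fact (a - s - 1) * (fact (k - s - 1))\<^sup>2)))"
    unfolding overlap_coeff_def atMost_atLeast0 min.idem
  proof (rule sum.cong[OF refl])
    fix s assume "s \<in> {0..min (a - 1) (k - 1)}"
    then have idx: "k - 1 + (k - 1) + (a - 1) + 1 - s = 2 * k + a - s - 2" "1 + 2 * s = 2 * s + 1"
        "k - 1 - s = k - s - 1" "a - 1 - s = a - s - 1"
      using assms by auto
    have "real s gchoose s = 1"
      by (simp flip: binomial_gbinomial)
    then have "root_coeff 1 s = 4 ^ s" by (simp add: root_coeff_def)
    then show "root_coeff 1 s * (fact (k - 1 + (k - 1) + (a - 1) + 1 - s)
         / (fact (1 + 2 * s) * fact (k - 1 - s) * fact (k - 1 - s) * fact (a - 1 - s)))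
      = 4 ^ s * (fact (2 * k + a - s - 2) /
             (fact (2 * s + 1) * fact (a - s - 1) * (fact (k - s - 1))\<^sup>2))"
      unfolding idx power2_eq_square by (simp only: mult_ac)
  qed
  have g: "(real k + real a - 1) gchoose k = real ((k + (a - 1)) choose k)"
    using assms by (simp add: binomial_gbinomial of_nat_diff add_diff_eq)
  obtain K where K: "2 * k = Suc K" using assms by (cases "2 * k") auto
  have pw: "real a ^ (2 * k) = real a * real a ^ (2 * k - 1)"
    "real a ^ (2 * k) = (real a ^ k)\<^sup>2"
    by (simp add: K) (simp add: mult.commute flip: power_mult)
  have "C k a = real a / real a ^ (2 * k) / fact (2 * k - 1) * covering_pairs (2 * k - 1) k k (a - 1) (a - 1)
      - (real ((k + (a - 1)) choose k))\<^sup>2 / real a ^ (2 * k) / (fact (k - 1))\<^sup>2"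
    unfolding C_def cov seg g by (simp add: right_diff_distrib)
  also have "real a / real a ^ (2 * k) = 1 / real a ^ (2 * k - 1)"
    unfolding pw(1) using assms by simp
  finally show ?thesis
    unfolding pw(2) by (simp add: power_divide power_mult_distrib)
qed

lemma C_pos:
  assumes "a \<ge> 2" "k \<ge> 2"
  shows "C k a > 0"
proof -
  obtain p where p: "k = Suc p" "p \<ge> 1" using assms by (cases k) auto
  obtain d where d: "a = Suc d" "d \<ge> 1" using assms by (cases a) auto
  define x where "x = real ((p + 1 + d) choose (p + 1))"
  define y where "y = covering_pairs (Suc (p + p)) (p + 1) (p + 1) d d"
  have gt: "(x / fact p)\<^sup>2 < real a / fact (Suc (p + p)) * y"
    using single_overlap_gt[OF p(2) d(2)] by (simp add: x_def y_def d(1) mult_2 del: covering_pairs.simps binomial_Suc_Suc fact_Suc)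
  have pw: "(real a ^ (p + 1))\<^sup>2 = real a * real a ^ Suc (p + p)"
    by (simp add: power2_eq_square power_add mult_ac)
  have cov: "covering_pairs (2 * k - 1) k k (a - 1) (a - 1) = y"
    unfolding y_def p(1) d(1) by (simp add: mult_2 del: covering_pairs.simps)
  have x: "real ((k + (a - 1)) choose k) = x"
    unfolding x_def p(1) d(1) by (simp del: binomial_Suc_Suc)
  have idx: "2 * k - 1 = Suc (p + p)" "k - 1 = p" "real a ^ k = real a ^ (p + 1)"
    by (simp_all add: p)
  have "C k a = covering_pairs (2 * k - 1) k k (a - 1) (a - 1) / real a ^ (2 * k - 1) / fact (2 * k - 1)
      - (real ((k + (a - 1)) choose k) / real a ^ k / fact (k - 1))\<^sup>2"
    using assms by (intro C_eq) auto
  also have "\<dots> = y / real a ^ Suc (p + p) / fact (Suc (p + p)) - (x / real a ^ (p + 1) / fact p)\<^sup>2"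
    unfolding cov x unfolding idx ..
  also have "\<dots> = (real a / fact (Suc (p + p)) * y - (x / fact p)\<^sup>2) / (real a * real a ^ Suc (p + p))"
    unfolding power_divide pw using d(1) by (simp add: diff_divide_distrib mult_ac del: power_Suc fact_Suc of_nat_Suc)
  also have "\<dots> > 0"
    using gt d(1) by (intro divide_pos_pos) simp_all
  finally show ?thesis .
qed

section \<open>Asymptotics of the moments\<close>

theorem theorem6p1:
  fixes a k :: nat
    and M :: "'b measure"
    and X :: "nat \<Rightarrow> 'b \<Rightarrow> nat"
  assumes "a \<ge> 2" and "k \<ge> 1"
    and "prob_space M"
    and "prob_space.indep_vars M (\<lambda>_. count_space UNIV) X {1..}"
    and "\<And>i. i \<ge> 1 \<Longrightarrow> distr M (count_space UNIV) (X i) = measure_pmf (pmf_of_set {1..a})"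
  shows
    "(\<lambda>n. prob_space.expectation M (\<lambda>\<omega>. (Y X n k \<omega>)\<^sup>2)) \<sim>[sequentially]
       (\<lambda>n. 1 / (fact k)\<^sup>2 * (1 / real a ^ (2 * k)) *
             ((real k + real a - 1) gchoose k)\<^sup>2 * real n ^ (2 * k))
     \<and> (\<forall>n. prob_space.expectation M (\<lambda>\<omega>. (Y X n k \<omega>)\<^sup>2) =
         (\<Sum>t = 0..k. \<Sum>s = 0..min (a - 1) (k - t).
            1 / real a ^ (2 * k - t) * 4 ^ (k - t)
            * (real n gchoose (2 * k - t))
            * ((real k - real t - real s - 1 / 2) gchoose (k - t - s))
            * ((real s + (real t + 1) / 2 - 1) gchoose s)
            * ((2 * real k - real t - real s + real a - 1) gchoose (t + 2 * s))
            * ((2 * real k - 2 * real t - 3 * real s + real a - 1) gchoose (a - 1 - s))))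
     \<and> (\<lambda>n. prob_space.variance M (Y X n k)) \<sim>[sequentially]
         (\<lambda>n. C k a * real n ^ (2 * k - 1))"
proof -
  interpret prob_space M by fact
  have a: "a \<ge> 1" using assms(1) by simp
  define b where "b m = covering_pairs m k k (a - 1) (a - 1) / real a ^ m" for m
  define e where "e = real ((k + (a - 1)) choose k) / real a ^ k"
  note moments = expectation_Y[OF assms(4,5) a] expectation_Y2[OF assms(4,5) a]
    integrable_Y[OF assms(4,5) a] integrable_Y2[OF assms(4,5) a]
  have EY2: "expectation (\<lambda>\<omega>. (Y X n k \<omega>)\<^sup>2) = (\<Sum>m\<le>2 * k. b m * real (n choose m))" for n
    unfolding b_def by (rule moments(2))
  have var: "variance (Y X n k) = (\<Sum>m\<le>2 * k. b m * real (n choose m)) - (e * real (n choose k))\<^sup>2" for n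
    using variance_eq[OF moments(3,4)] EY2 moments(1) by (simp only: e_def)
  have e_pos: "e > 0" using a by (simp add: e_def)
  have top: "b (2 * k) / fact (2 * k) = (e / fact k)\<^sup>2"
  proof -
    have "b (2 * k) = real ((k + k) choose k) * (real ((k + (a - 1)) choose k))\<^sup>2 / (real a ^ k)\<^sup>2"
      using covering_pairs_no_overlap[of k k "a - 1" "a - 1"]
      by (simp add: b_def mult_2 power2_eq_square power_add)
    also have "real ((k + k) choose k) = fact (2 * k) / (fact k)\<^sup>2"
      by (simp add: binomial_fact mult_2 power2_eq_square)
    finally show ?thesis by (simp add: e_def power_divide power_mult_distrib mult.commute)
  qed
  have g: "(real k + real a - 1) gchoose k = real ((k + (a - 1)) choose k)"
    using a by (simp add: binomial_gbinomial of_nat_diff add_diff_eq)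
  have "(\<lambda>n. \<Sum>m\<le>2 * k. b m * real (n choose m)) \<sim>[sequentially] (\<lambda>n. (e / fact k)\<^sup>2 * real n ^ (2 * k))"
    using binomial_sum_leading_term[of b "2 * k"] e_pos unfolding top
    by (intro asymp_equiv_power_of_tendsto) simp_all
  moreover have "(e / fact k)\<^sup>2 = 1 / (fact k)\<^sup>2 * (1 / real a ^ (2 * k)) * ((real k + real a - 1) gchoose k)\<^sup>2"
    unfolding g e_def by (simp add: power_divide power_mult_distrib mult.commute flip: power_mult)
  ultimately have part1: "(\<lambda>n. expectation (\<lambda>\<omega>. (Y X n k \<omega>)\<^sup>2)) \<sim>[sequentially]
       (\<lambda>n. 1 / (fact k)\<^sup>2 * (1 / real a ^ (2 * k)) *
             ((real k + real a - 1) gchoose k)\<^sup>2 * real n ^ (2 * k))"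
    by (simp only: EY2)
  have part2: "expectation (\<lambda>\<omega>. (Y X n k \<omega>)\<^sup>2) =
         (\<Sum>t = 0..k. \<Sum>s = 0..min (a - 1) (k - t).
            1 / real a ^ (2 * k - t) * 4 ^ (k - t)
            * (real n gchoose (2 * k - t))
            * ((real k - real t - real s - 1 / 2) gchoose (k - t - s))
            * ((real s + (real t + 1) / 2 - 1) gchoose s)
            * ((2 * real k - real t - real s + real a - 1) gchoose (t + 2 * s))
            * ((2 * real k - 2 * real t - 3 * real s + real a - 1) gchoose (a - 1 - s)))" for n
  proof (rule trans[OF trans[OF moments(2) sum_covering_pairs_by_overlap[OF a]] sum.cong[OF refl]])
    fix t assume "t \<in> {0..k}"
    then have t: "t \<le> k" by simp
    show "overlap_coeff t (k - t) (k - t) (a - 1) / real a ^ (2 * k - t) * real (n choose (2 * k - t))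
      = (\<Sum>s = 0..min (a - 1) (k - t).
            1 / real a ^ (2 * k - t) * 4 ^ (k - t)
            * (real n gchoose (2 * k - t))
            * ((real k - real t - real s - 1 / 2) gchoose (k - t - s))
            * ((real s + (real t + 1) / 2 - 1) gchoose s)
            * ((2 * real k - real t - real s + real a - 1) gchoose (t + 2 * s))
            * ((2 * real k - 2 * real t - 3 * real s + real a - 1) gchoose (a - 1 - s)))"
      unfolding overlap_coeff_eq_gchoose[OF t a] binomial_gbinomial sum_divide_distrib sum_distrib_right
      by (rule sum.cong[OF refl]) (simp only: times_divide_eq_left times_divide_eq_right mult_1_left mult_ac)
  qed
  have limit: "(\<lambda>n. variance (Y X n k) / real n ^ (2 * k - 1)) \<longlonglongrightarrow> C k a"
    using variance_leading_term[where b = b and e = e, OF assms(2) top] unfolding var C_eq[OF a assms(2)] b_def e_def .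
  have part3: "(\<lambda>n. variance (Y X n k)) \<sim>[sequentially] (\<lambda>n. C k a * real n ^ (2 * k - 1))"
  proof (cases "k = 1")
    \<comment> \<open>Here \<open>Y X n 1 = n\<close>: variance and constant both vanish.\<close>
    case True
    have choose2: "real (n choose Suc (Suc 0)) = real n * (real n - 1) / 2" for n
      by (induction n) (simp_all add: field_simps)
    have b_small: "b 0 = 0" "b (Suc 0) = 1" "b (Suc (Suc 0)) = 2"
    proof -
      show "b 0 = 0" using True by (simp add: b_def)
      show "b (Suc 0) = 1" using True a by (simp add: b_def)
      have "covering_pairs (Suc (Suc 0)) 1 1 (a - 1) (a - 1) = 2 * (real a)\<^sup>2"
        using covering_pairs_no_overlap[of 1 1 "a - 1" "a - 1"] a
        by (simp add: power2_eq_square del: covering_pairs.simps)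
      then show "b (Suc (Suc 0)) = 2" using True a by (simp add: b_def power2_eq_square del: covering_pairs.simps)
    qed
    have e1: "e = 1" using True a by (simp add: e_def)
    have zero: "variance (Y X n k) = 0" for n
      unfolding var using True by (simp add: numeral_2_eq_2 b_small e1 choose2) (simp add: field_simps)
    have "(\<lambda>n. 0) \<longlonglongrightarrow> C k a"
      using limit unfolding zero by simp
    then have "C k a = 0" by (simp add: LIMSEQ_const_iff)
    then show ?thesis unfolding zero by simp
  next
    case False
    then have "C k a > 0" using assms(1,2) by (intro C_pos) auto
    then show ?thesis using limit by (intro asymp_equiv_power_of_tendsto) auto
  qed
  show ?thesis using part1 part2 part3 by blast
qed

end
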